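(* Let $\mathscr{D}$ be a complex vector space and let $\mathfrak{t},\mathfrak{w}$ be nonnegative Hermitian forms on $\mathscr{D}$. With the Hilbert spaces $H_{\mathfrak t},H_{\mathfrak w},H_{\mathfrak t+\mathfrak w}$, the operators $J_T,J_W:H_{\mathfrak t}\times H_{\mathfrak w}\to H_{\mathfrak t+\mathfrak w}$ and the projection $P$ defined in the context, the positive operators $J_TPJ_T^*$ and $J_WPJ_W^*$ on $H_{\mathfrak t+\mathfrak w}$ are equal, and the form $$(\mathfrak{t}:\mathfrak{w})(x,y):=\big(J_TPJ_T^*(x+N_{\mathfrak t+\mathfrak w})\mid y+N_{\mathfrak t+\mathfrak w}\big)_{\mathfrak t+\mathfrak w},\qquad x,y\in\mathscr{D},$$ satisfies $$(\mathfrak{t}:\mathfrak{w})(x,x)=\inf\{\mathfrak{t}(x-y,x-y)+\mathfrak{w}(y,y):y\in\mathscr{D}\},\qquad x\in\mathscr{D}.$$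
   Context: Inner products are linear in the first variable, and a nonnegative Hermitian form on $\mathscr{D}$ is a sesquilinear form $\mathfrak t:\mathscr D\times\mathscr D\to\mathbb C$ (linear in the first variable) with $\mathfrak t(x,x)\ge0$ for all $x$. For such $\mathfrak t$ put $N_{\mathfrak t}:=\{x\in\mathscr{D}:\mathfrak t(x,x)=0\}$, a linear subspace; $(x+N_{\mathfrak t}\mid y+N_{\mathfrak t})_{\mathfrak t}:=\mathfrak t(x,y)$ is an inner product on $\mathscr{D}/N_{\mathfrak t}$, and $H_{\mathfrak t}$ is its Hilbert space completion. $N_{\mathfrak w},H_{\mathfrak w}$ and $N_{\mathfrak t+\mathfrak w},H_{\mathfrak t+\mathfrak w}$ are defined analogously from $\mathfrak w$ and $\mathfrak t+\mathfrak w$. $T,W\in\mathscr{B}(H_{\mathfrak t+\mathfrak w})$ are the bounded positive operators determined (via Riesz representation) by $$(T(x+N_{\mathfrak t+\mathfrak w})\mid y+N_{\mathfrak t+\mathfrak w})_{\mathfrak t+\mathfrak w}=\mathfrak t(x,y),\qquad (W(x+N_{\mathfrak t+\mathfrak w})\mid y+N_{\mathfrak t+\mathfrak w})_{\mathfrak t+\mathfrak w}=\mathfrak w(x,y),\qquad x,y\in\mathscr{D}.$$ The bounded operators $J,J_T,J_W$ from the product Hilbert space $H_{\mathfrak t}\times H_{\mathfrak w}$ into $H_{\mathfrak t+\mathfrak w}$ are the continuous extensions of $$J(x+N_{\mathfrak t},y+N_{\mathfrak w}):=T(x+N_{\mathfrak t+\mathfrak w})+W(y+N_{\mathfrak t+\mathfrak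 w}),$$ $$J_T(x+N_{\mathfrak t},y+N_{\mathfrak w}):=T(x+N_{\mathfrak t+\mathfrak w}),\qquad J_W(x+N_{\mathfrak t},y+N_{\mathfrak w}):=W(y+N_{\mathfrak t+\mathfrak w}),$$ for $x,y\in\mathscr{D}$. Their adjoints satisfy $J^*(x+N_{\mathfrak t+\mathfrak w})=(x+N_{\mathfrak t},x+N_{\mathfrak w})$, $J_T^*(x+N_{\mathfrak t+\mathfrak w})=(x+N_{\mathfrak t},0)$, $J_W^*(x+N_{\mathfrak t+\mathfrak w})=(0,x+N_{\mathfrak w})$. $P$ is the orthogonal projection of $H_{\mathfrak t}\times H_{\mathfrak w}$ onto $\{\operatorname{ran}J^*\}^{\perp}$. *)

theory Defs
  imports "HOL-Analysis.Analysis" "HOL-Library.Set_Algebras"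
begin

text \<open>A nonnegative Hermitian form on the complex vector space given by the type \<open>'a\<close> with
  scalar multiplication \<open>s\<close>; all inner products are linear in the first variable.\<close>

definition nonneg_form :: "(complex \<Rightarrow> 'a::ab_group_add \<Rightarrow> 'a) \<Rightarrow> ('a \<Rightarrow> 'a \<Rightarrow> complex) \<Rightarrow> bool" where
  "nonneg_form s t \<longleftrightarrow>
     (\<forall>y. Vector_Spaces.linear s (*) (\<lambda>x. t x y)) \<and>
     (\<forall>x. Vector_Spaces.linear s (*) (\<lambda>y. cnj (t x y))) \<and>
     (\<forall>x. t x x \<in> \<real>\<^sub>\<ge>\<^sub>0)"

definition form_sum :: "('a \<Rightarrow> 'a \<Rightarrow> complex) \<Rightarrow> ('a \<Rightarrow> 'a \<Rightarrow> complex) \<Rightarrow> 'a \<Rightarrow> 'a \<Rightarrow> complex" where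
  "form_sum t w = (\<lambda>x y. t x y + w x y)"

text \<open>The spaces \<open>H\<^sub>\<t>\<close> depend on the form, so they are carrier sets with explicit operations,
  not types. The operations matter only on the carrier.\<close>

record 'v ip_space =
  vcarrier :: "'v set"
  vadd :: "'v \<Rightarrow> 'v \<Rightarrow> 'v"
  vscale :: "complex \<Rightarrow> 'v \<Rightarrow> 'v"
  ip :: "'v \<Rightarrow> 'v \<Rightarrow> complex"

definition vdiff :: "'v ip_space \<Rightarrow> 'v \<Rightarrow> 'v \<Rightarrow> 'v" where
  "vdiff X x y = vadd X x (vscale X (-1) y)"

definition vnorm :: "'v ip_space \<Rightarrow> 'v \<Rightarrow> real" where
  "vnorm X x = sqrt (Re (ip X x x))"

definition null_space :: "('a \<Rightarrow> 'a \<Rightarrow> complex) \<Rightarrow> 'a set" where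
  "null_space t = {x. t x x = 0}"

text \<open>The quotient of the whole space by \<open>null_space t\<close>; its points are the cosets
  \<open>x +o null_space t\<close>. Adding the null space in \<open>vscale\<close> is needed only for the scalar 0.\<close>

definition quotient_space ::
    "(complex \<Rightarrow> 'a::ab_group_add \<Rightarrow> 'a) \<Rightarrow> ('a \<Rightarrow> 'a \<Rightarrow> complex) \<Rightarrow> 'a set ip_space" where
  "quotient_space s t =
     \<lparr>vcarrier = range (\<lambda>x. x +o null_space t),
      vadd = (\<lambda>A B. A + B),
      vscale = (\<lambda>c A. s c ` A + null_space t),
      ip = (\<lambda>A B. THE z. \<exists>x\<in>A. \<exists>y\<in>B. z = t x y)\<rparr>"

text \<open>The completion of an inner product space: classes of Cauchy sequences modulo sequences
  tending to zero.\<close>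

definition cauchy_seqs :: "'v ip_space \<Rightarrow> (nat \<Rightarrow> 'v) set" where
  "cauchy_seqs X = {f. range f \<subseteq> vcarrier X \<and>
     (\<forall>e>0. \<exists>N. \<forall>m\<ge>N. \<forall>n\<ge>N. vnorm X (vdiff X (f m) (f n)) < e)}"

definition cauchy_rel :: "'v ip_space \<Rightarrow> ((nat \<Rightarrow> 'v) \<times> (nat \<Rightarrow> 'v)) set" where
  "cauchy_rel X = {(f, g). f \<in> cauchy_seqs X \<and> g \<in> cauchy_seqs X \<and>
     (\<lambda>n. vnorm X (vdiff X (f n) (g n))) \<longlonglongrightarrow> 0}"

definition completion :: "'v ip_space \<Rightarrow> (nat \<Rightarrow> 'v) set ip_space" where
  "completion X =
     \<lparr>vcarrier = cauchy_seqs X // cauchy_rel X,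
      vadd = (\<lambda>A B. \<Union>f\<in>A. \<Union>g\<in>B. cauchy_rel X `` {\<lambda>n. vadd X (f n) (g n)}),
      vscale = (\<lambda>c A. \<Union>f\<in>A. cauchy_rel X `` {\<lambda>n. vscale X c (f n)}),
      ip = (\<lambda>A B. THE z. \<exists>f\<in>A. \<exists>g\<in>B. (\<lambda>n. ip X (f n) (g n)) \<longlonglongrightarrow> z)\<rparr>"

definition embed :: "'v ip_space \<Rightarrow> 'v \<Rightarrow> (nat \<Rightarrow> 'v) set" where
  "embed X x = cauchy_rel X `` {\<lambda>_. x}"

type_synonym 'a form_elem = "(nat \<Rightarrow> 'a set) set"

definition form_hilbert ::
    "(complex \<Rightarrow> 'a::ab_group_add \<Rightarrow> 'a) \<Rightarrow> ('a \<Rightarrow> 'a \<Rightarrow> complex) \<Rightarrow> 'a form_elem ip_space" where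
  "form_hilbert s t = completion (quotient_space s t)"

text \<open>The coset \<open>x + N\<^sub>\<t>\<close>, regarded as an element of \<open>H\<^sub>\<t>\<close>.\<close>

definition coset ::
    "(complex \<Rightarrow> 'a::ab_group_add \<Rightarrow> 'a) \<Rightarrow> ('a \<Rightarrow> 'a \<Rightarrow> complex) \<Rightarrow> 'a \<Rightarrow> 'a form_elem" where
  "coset s t x = embed (quotient_space s t) (x +o null_space t)"

definition ip_prod :: "'v ip_space \<Rightarrow> 'u ip_space \<Rightarrow> ('v \<times> 'u) ip_space" where
  "ip_prod X Y =
     \<lparr>vcarrier = vcarrier X \<times> vcarrier Y,
      vadd = (\<lambda>(x, y) (x', y'). (vadd X x x', vadd Y y y')),
      vscale = (\<lambda>c (x, y). (vscale X c x, vscale Y c y)),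
      ip = (\<lambda>(x, y) (x', y'). ip X x x' + ip Y y y')\<rparr>"

text \<open>Operators are \<open>undefined\<close> off the carrier of their domain, so that equality of operators is
  equality of functions and the definite descriptions below are meaningful.\<close>

definition bounded_ops :: "'v ip_space \<Rightarrow> 'u ip_space \<Rightarrow> ('v \<Rightarrow> 'u) set" where
  "bounded_ops X Y = {A \<in> vcarrier X \<rightarrow>\<^sub>E vcarrier Y.
     (\<forall>x\<in>vcarrier X. \<forall>y\<in>vcarrier X. A (vadd X x y) = vadd Y (A x) (A y)) \<and>
     (\<forall>c. \<forall>x\<in>vcarrier X. A (vscale X c x) = vscale Y c (A x)) \<and>
     (\<exists>C. \<forall>x\<in>vcarrier X. vnorm Y (A x) \<le> C * vnorm X x)}"

definition positive_op :: "'v ip_space \<Rightarrow> ('v \<Rightarrow> 'v) \<Rightarrow> bool" where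
  "positive_op X A \<longleftrightarrow> A \<in> bounded_ops X X \<and> (\<forall>x\<in>vcarrier X. ip X (A x) x \<in> \<real>\<^sub>\<ge>\<^sub>0)"

definition adjoint_op :: "'v ip_space \<Rightarrow> 'u ip_space \<Rightarrow> ('v \<Rightarrow> 'u) \<Rightarrow> 'u \<Rightarrow> 'v" where
  "adjoint_op X Y A = (THE B. B \<in> bounded_ops Y X \<and>
     (\<forall>x\<in>vcarrier X. \<forall>y\<in>vcarrier Y. ip Y (A x) y = ip X x (B y)))"

definition ortho_compl :: "'v ip_space \<Rightarrow> 'v set \<Rightarrow> 'v set" where
  "ortho_compl X S = {x \<in> vcarrier X. \<forall>y\<in>S. ip X x y = 0}"

definition ortho_proj :: "'v ip_space \<Rightarrow> 'v set \<Rightarrow> 'v \<Rightarrow> 'v" where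
  "ortho_proj X M = (\<lambda>x\<in>vcarrier X. THE p. p \<in> M \<and> vdiff X x p \<in> ortho_compl X M)"

text \<open>The operator on \<open>form_hilbert s r\<close> representing the form \<open>t\<close>; with \<open>r = form_sum t w\<close> it is
  the operator \<open>T\<close>, and for \<open>w\<close> in place of \<open>t\<close> it is \<open>W\<close>.\<close>

definition repr_op ::
    "(complex \<Rightarrow> 'a::ab_group_add \<Rightarrow> 'a) \<Rightarrow> ('a \<Rightarrow> 'a \<Rightarrow> complex) \<Rightarrow> ('a \<Rightarrow> 'a \<Rightarrow> complex) \<Rightarrow>
     'a form_elem \<Rightarrow> 'a form_elem" where
  "repr_op s r t = (THE A. A \<in> bounded_ops (form_hilbert s r) (form_hilbert s r) \<and>
     (\<forall>x y. ip (form_hilbert s r) (A (coset s r x)) (coset s r y) = t x y))"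

definition form_prod ::
    "(complex \<Rightarrow> 'a::ab_group_add \<Rightarrow> 'a) \<Rightarrow> ('a \<Rightarrow> 'a \<Rightarrow> complex) \<Rightarrow> ('a \<Rightarrow> 'a \<Rightarrow> complex) \<Rightarrow>
     ('a form_elem \<times> 'a form_elem) ip_space" where
  "form_prod s t w = ip_prod (form_hilbert s t) (form_hilbert s w)"

text \<open>The continuous extension to \<open>H\<^sub>\<t> \<times> H\<^sub>\<w>\<close> of the map sending
  \<open>(x + N\<^sub>\<t>, y + N\<^sub>\<w>)\<close> to \<open>F x y\<close> in \<open>H\<^sub>\<t>\<^sub>+\<^sub>\<w>\<close>.\<close>

definition extend_op ::
    "(complex \<Rightarrow> 'a::ab_group_add \<Rightarrow> 'a) \<Rightarrow> ('a \<Rightarrow> 'a \<Rightarrow> complex) \<Rightarrow> ('a \<Rightarrow> 'a \<Rightarrow> complex) \<Rightarrow>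
     ('a \<Rightarrow> 'a \<Rightarrow> 'a form_elem) \<Rightarrow> 'a form_elem \<times> 'a form_elem \<Rightarrow> 'a form_elem" where
  "extend_op s t w F =
     (THE A. A \<in> bounded_ops (form_prod s t w) (form_hilbert s (form_sum t w)) \<and>
       (\<forall>x y. A (coset s t x, coset s w y) = F x y))"

definition J_op ::
    "(complex \<Rightarrow> 'a::ab_group_add \<Rightarrow> 'a) \<Rightarrow> ('a \<Rightarrow> 'a \<Rightarrow> complex) \<Rightarrow> ('a \<Rightarrow> 'a \<Rightarrow> complex) \<Rightarrow>
     'a form_elem \<times> 'a form_elem \<Rightarrow> 'a form_elem" where
  "J_op s t w = (let r = form_sum t w in extend_op s t w (\<lambda>x y.
     vadd (form_hilbert s r) (repr_op s r t (coset s r x)) (repr_op s r w (coset s r y))))"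

definition JT_op ::
    "(complex \<Rightarrow> 'a::ab_group_add \<Rightarrow> 'a) \<Rightarrow> ('a \<Rightarrow> 'a \<Rightarrow> complex) \<Rightarrow> ('a \<Rightarrow> 'a \<Rightarrow> complex) \<Rightarrow>
     'a form_elem \<times> 'a form_elem \<Rightarrow> 'a form_elem" where
  "JT_op s t w = (let r = form_sum t w in extend_op s t w (\<lambda>x y. repr_op s r t (coset s r x)))"

definition JW_op ::
    "(complex \<Rightarrow> 'a::ab_group_add \<Rightarrow> 'a) \<Rightarrow> ('a \<Rightarrow> 'a \<Rightarrow> complex) \<Rightarrow> ('a \<Rightarrow> 'a \<Rightarrow> complex) \<Rightarrow>
     'a form_elem \<times> 'a form_elem \<Rightarrow> 'a form_elem" where
  "JW_op s t w = (let r = form_sum t w in extend_op s t w (\<lambda>x y. repr_op s r w (coset s r y)))"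

definition P_op ::
    "(complex \<Rightarrow> 'a::ab_group_add \<Rightarrow> 'a) \<Rightarrow> ('a \<Rightarrow> 'a \<Rightarrow> complex) \<Rightarrow> ('a \<Rightarrow> 'a \<Rightarrow> complex) \<Rightarrow>
     'a form_elem \<times> 'a form_elem \<Rightarrow> 'a form_elem \<times> 'a form_elem" where
  "P_op s t w = (let H = form_hilbert s (form_sum t w); K = form_prod s t w in
     ortho_proj K (ortho_compl K (adjoint_op K H (J_op s t w) ` vcarrier H)))"

text \<open>The operator \<open>A P A\<^sup>*\<close> on \<open>H\<^sub>\<t>\<^sub>+\<^sub>\<w>\<close>, for \<open>A\<close> from \<open>H\<^sub>\<t> \<times> H\<^sub>\<w>\<close> to \<open>H\<^sub>\<t>\<^sub>+\<^sub>\<w>\<close>.\<close>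

definition compress_P ::
    "(complex \<Rightarrow> 'a::ab_group_add \<Rightarrow> 'a) \<Rightarrow> ('a \<Rightarrow> 'a \<Rightarrow> complex) \<Rightarrow> ('a \<Rightarrow> 'a \<Rightarrow> complex) \<Rightarrow>
     ('a form_elem \<times> 'a form_elem \<Rightarrow> 'a form_elem) \<Rightarrow> 'a form_elem \<Rightarrow> 'a form_elem" where
  "compress_P s t w A = (let H = form_hilbert s (form_sum t w); K = form_prod s t w in
     compose (vcarrier H) A (compose (vcarrier H) (P_op s t w) (adjoint_op K H A)))"

definition parallel_sum ::
    "(complex \<Rightarrow> 'a::ab_group_add \<Rightarrow> 'a) \<Rightarrow> ('a \<Rightarrow> 'a \<Rightarrow> complex) \<Rightarrow> ('a \<Rightarrow> 'a \<Rightarrow> complex) \<Rightarrow>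
     'a \<Rightarrow> 'a \<Rightarrow> complex" where
  "parallel_sum s t w x y = (let r = form_sum t w in
     ip (form_hilbert s r) (compress_P s t w (JT_op s t w) (coset s r x)) (coset s r y))"

end

theory Submission
  imports Defs
begin

text \<open>Let \<open>i\<^sub>\<t>\<close>, \<open>i\<^sub>\<w>\<close> be the contractions of \<open>H\<^sub>\<t>\<^sub>+\<^sub>\<w>\<close> into \<open>H\<^sub>\<t>\<close>, \<open>H\<^sub>\<w>\<close> induced by the identity of \<open>\<D>\<close>. Then
  \<open>T = i\<^sub>\<t>\<^sup>* i\<^sub>\<t>\<close>, \<open>W = i\<^sub>\<w>\<^sup>* i\<^sub>\<w>\<close>, \<open>T + W = I\<close>, and \<open>J\<^sup>* = (i\<^sub>\<t>, i\<^sub>\<w>)\<close> is an isometry, so \<open>P = I - J\<^sup>* J\<close>. Hence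
  \<open>J\<^sub>T P J\<^sub>T\<^sup>* = T - T\<^sup>2 = W - W\<^sup>2 = J\<^sub>W P J\<^sub>W\<^sup>*\<close>. Completing the square,
  \<open>\<t>(x - y, x - y) + \<w>(y, y) = ((T - T\<^sup>2) x | x) + \<parallel>T x - y\<parallel>\<^sup>2\<close>, and the last term has infimum 0 because the
  cosets are dense. The operators \<open>i\<^sub>\<t>\<^sup>*\<close>, \<open>i\<^sub>\<t>\<close> are both obtained from Riesz representation on the dense
  space of cosets, so completeness of the product space is not needed.\<close>

section \<open>Inner product spaces on carrier sets\<close>

text \<open>The operators of the statement are given by definite descriptions, so each has to be
  exhibited by a formula and shown unique. The formulas are built from the maps that Riesz
  representation provides; uniqueness comes from density of the cosets for representing and extended
  operators, and from definiteness for adjoints and the projection. Completeness enters only inside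
  \<open>riesz\<close>, and only for Cauchy sequences of cosets: such a sequence is itself a
  representative of its limit, so no diagonal argument over classes occurs. The projection is
  likewise verified from its formula instead of being drawn from a projection theorem. Since the
  carriers are sets in a record without vector space laws, identities between vectors are proved by
  comparing inner products, and by density this comes down to values of the forms.\<close>

lemma null_seq_le:
  fixes f :: "nat \<Rightarrow> 'a::real_normed_vector"
  assumes "g \<longlonglongrightarrow> 0" "\<And>n. norm (f n) \<le> g n"
  shows "f \<longlonglongrightarrow> 0"
  using assms by (intro Lim_null_comparison[of f g]) simp_all

text \<open>Definiteness is left out so that the form on the original vector space is an instance,
  which gives Cauchy-Schwarz before any quotient is taken. In place of vector space laws, norms of
  differently bracketed vectors are compared by \<open>vnorm_cong\<close>.\<close>

locale semi_ip =
  fixes X :: "'v ip_space"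
  assumes nonempty: "vcarrier X \<noteq> {}"
    and add_closed [simp]: "x \<in> vcarrier X \<Longrightarrow> y \<in> vcarrier X \<Longrightarrow> vadd X x y \<in> vcarrier X"
    and scale_closed [simp]: "x \<in> vcarrier X \<Longrightarrow> vscale X c x \<in> vcarrier X"
    and ip_add [simp]: "x \<in> vcarrier X \<Longrightarrow> y \<in> vcarrier X \<Longrightarrow> z \<in> vcarrier X \<Longrightarrow>
      ip X (vadd X x y) z = ip X x z + ip X y z"
    and ip_scale [simp]: "x \<in> vcarrier X \<Longrightarrow> y \<in> vcarrier X \<Longrightarrow>
      ip X (vscale X c x) y = c * ip X x y"
    and ip_cnj: "x \<in> vcarrier X \<Longrightarrow> y \<in> vcarrier X \<Longrightarrow> ip X y x = cnj (ip X x y)"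
    and ip_nonneg: "x \<in> vcarrier X \<Longrightarrow> 0 \<le> Re (ip X x x)"
begin

lemma ip_add_right [simp]:
  assumes "x \<in> vcarrier X" "y \<in> vcarrier X" "z \<in> vcarrier X"
  shows "ip X z (vadd X x y) = ip X z x + ip X z y"
  using assms ip_cnj[of "vadd X x y" z] ip_cnj[of x z] ip_cnj[of y z] by simp

lemma ip_scale_right [simp]:
  assumes "x \<in> vcarrier X" "y \<in> vcarrier X"
  shows "ip X x (vscale X c y) = cnj c * ip X x y"
  using assms ip_cnj[of "vscale X c y" x] ip_cnj[of y x] by simp

lemma diff_closed [simp]: "x \<in> vcarrier X \<Longrightarrow> y \<in> vcarrier X \<Longrightarrow> vdiff X x y \<in> vcarrier X"
  by (simp add: vdiff_def)

lemma ip_diff [simp]: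
  "x \<in> vcarrier X \<Longrightarrow> y \<in> vcarrier X \<Longrightarrow> z \<in> vcarrier X \<Longrightarrow>
    ip X (vdiff X x y) z = ip X x z - ip X y z"
  by (simp add: vdiff_def)

lemma ip_diff_right [simp]:
  "x \<in> vcarrier X \<Longrightarrow> y \<in> vcarrier X \<Longrightarrow> z \<in> vcarrier X \<Longrightarrow>
    ip X z (vdiff X x y) = ip X z x - ip X z y"
  by (simp add: vdiff_def)

lemma Im_ip_self [simp]: "x \<in> vcarrier X \<Longrightarrow> Im (ip X x x) = 0"
  using ip_cnj[of x x] by (metis Reals_cnj_iff complex_is_Real_iff)

lemma vnorm_nonneg [simp]: "x \<in> vcarrier X \<Longrightarrow> 0 \<le> vnorm X x"
  by (simp add: vnorm_def ip_nonneg)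

lemma vnorm_sq: "x \<in> vcarrier X \<Longrightarrow> (vnorm X x)\<^sup>2 = Re (ip X x x)"
  by (simp add: vnorm_def ip_nonneg)

lemma ip_self: "x \<in> vcarrier X \<Longrightarrow> ip X x x = complex_of_real ((vnorm X x)\<^sup>2)"
  by (simp add: vnorm_sq complex_eq_iff)

lemma Re_ip_commute: "x \<in> vcarrier X \<Longrightarrow> y \<in> vcarrier X \<Longrightarrow> Re (ip X y x) = Re (ip X x y)"
  by (subst ip_cnj[of x y]) simp_all

text \<open>The common expansion behind Cauchy-Schwarz, polarisation and the variational argument in
  \<open>riesz\<close>.\<close>

lemma vnorm_sq_add_scale:
  assumes "x \<in> vcarrier X" "y \<in> vcarrier X"
  shows "(vnorm X (vadd X x (vscale X c y)))\<^sup>2 =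
    (vnorm X x)\<^sup>2 + 2 * Re (c * ip X y x) + (cmod c)\<^sup>2 * (vnorm X y)\<^sup>2"
proof -
  have "cnj c * ip X x y = cnj (c * ip X y x)"
    using ip_cnj[of y x] assms by simp
  then have "Re (cnj c * ip X x y) = Re (c * ip X y x)"
    by (metis cnj.simps(1))
  moreover have "c * (cnj c * ip X y y) = of_real ((cmod c)\<^sup>2 * (vnorm X y)\<^sup>2)"
    using assms by (simp add: ip_self mult.assoc[symmetric] complex_norm_square[symmetric])
  moreover have "Re (c * (cnj c * ip X y y)) = (cmod c)\<^sup>2 * (vnorm X y)\<^sup>2"
    by (subst calculation(2)) (rule Re_complex_of_real)
  ultimately show ?thesis
    using assms by (simp add: vnorm_sq algebra_simps)
qed

lemma vnorm_scale: "x \<in> vcarrier X \<Longrightarrow> vnorm X (vscale X c x) = cmod c * vnorm X x"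
proof -
  assume x: "x \<in> vcarrier X"
  have "c * (cnj c * ip X x x) = of_real ((cmod c * vnorm X x)\<^sup>2)"
    using x by (simp add: ip_self mult.assoc[symmetric] complex_norm_square[symmetric] power_mult_distrib)
  then have "(vnorm X (vscale X c x))\<^sup>2 = (cmod c * vnorm X x)\<^sup>2"
    using x by (metis Re_complex_of_real ip_scale ip_scale_right scale_closed vnorm_sq)
  then show ?thesis
    using x by simp
qed

lemma cauchy_schwarz:
  assumes x: "x \<in> vcarrier X" and y: "y \<in> vcarrier X"
  shows "cmod (ip X x y) \<le> vnorm X x * vnorm X y"
proof -
  define d where "d = (cmod (ip X x y))\<^sup>2"
  define a where "a = (vnorm X x)\<^sup>2"
  define b where "b = (vnorm X y)\<^sup>2"
  \<comment> \<open>The right side is the squared norm of x - u (x | y) y. It is used at the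
    minimiser u = 1 / b; if b = 0 it is affine in u, and u = (a + 1) / (2 d) would give it the value
    -1.\<close>
  have *: "0 \<le> a - 2 * u * d + u\<^sup>2 * d * b" for u :: real
  proof -
    let ?c = "complex_of_real (- u) * ip X x y"
    have "?c * ip X y x = of_real (- u * d)"
      using complex_norm_square[of "ip X x y"] ip_cnj[OF x y] by (simp add: d_def mult.assoc)
    then have "Re (?c * ip X y x) = - u * d"
      by (metis Re_complex_of_real)
    moreover have "(cmod ?c)\<^sup>2 = u\<^sup>2 * d"
      by (simp add: norm_mult power_mult_distrib d_def)
    ultimately have "(vnorm X (vadd X x (vscale X ?c y)))\<^sup>2 = a + 2 * (- u * d) + u\<^sup>2 * d * b"
      unfolding vnorm_sq_add_scale[OF x y] a_def b_def by (simp only:)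
    moreover have "0 \<le> (vnorm X (vadd X x (vscale X ?c y)))\<^sup>2"
      by simp
    ultimately show ?thesis
      by (simp add: mult.assoc)
  qed
  have "d \<le> a * b"
  proof (cases "b = 0")
    case True
    have "d = 0"
    proof (rule ccontr)
      assume "d \<noteq> 0"
      then have "2 * ((a + 1) / (2 * d)) * d = a + 1"
        by simp
      then show False
        using *[of "(a + 1) / (2 * d)"] True by simp
    qed
    then show ?thesis
      using True by simp
  next
    case False
    then have b: "b > 0"
      by (simp add: b_def)
    then have "(1 / b)\<^sup>2 * d * b = d / b"
      by (simp add: power2_eq_square)
    then have "d / b \<le> a"
      using *[of "1 / b"] by simp
    then show ?thesis
      using b by (simp add: pos_divide_le_eq)
  qed
  then have "(cmod (ip X x y))\<^sup>2 \<le> (vnorm X x * vnorm X y)\<^sup>2"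
    by (simp add: a_def b_def d_def power_mult_distrib)
  then show ?thesis
    using x y by (simp add: power2_le_iff_abs_le)
qed

lemma vnorm_triangle:
  assumes x: "x \<in> vcarrier X" and y: "y \<in> vcarrier X"
  shows "vnorm X (vadd X x y) \<le> vnorm X x + vnorm X y"
proof -
  have "(vnorm X (vadd X x y))\<^sup>2 = (vnorm X x)\<^sup>2 + 2 * Re (ip X x y) + (vnorm X y)\<^sup>2"
    using x y Re_ip_commute[OF x y] by (simp add: vnorm_sq)
  also have "\<dots> \<le> (vnorm X x)\<^sup>2 + 2 * (vnorm X x * vnorm X y) + (vnorm X y)\<^sup>2"
    using cauchy_schwarz[OF x y] complex_Re_le_cmod[of "ip X x y"] by simp
  also have "\<dots> = (vnorm X x + vnorm X y)\<^sup>2"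
    by (simp add: power2_eq_square algebra_simps)
  finally show ?thesis
    using x y by (simp add: power2_le_iff_abs_le)
qed

lemma vnorm_cong:
  "ip X x x = ip X y y \<Longrightarrow> vnorm X x = vnorm X y"
  by (simp add: vnorm_def)

lemma vnorm_diff_commute:
  "x \<in> vcarrier X \<Longrightarrow> y \<in> vcarrier X \<Longrightarrow> vnorm X (vdiff X x y) = vnorm X (vdiff X y x)"
  by (rule vnorm_cong) simp

lemma vnorm_diff_triangle:
  assumes "x \<in> vcarrier X" "y \<in> vcarrier X" "z \<in> vcarrier X"
  shows "vnorm X (vdiff X x z) \<le> vnorm X (vdiff X x y) + vnorm X (vdiff X y z)"
proof -
  have "vnorm X (vdiff X x z) = vnorm X (vadd X (vdiff X x y) (vdiff X y z))"
    using assms by (intro vnorm_cong) simp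
  then show ?thesis
    using assms by (simp add: vnorm_triangle)
qed

lemma vnorm_le_diff:
  assumes "x \<in> vcarrier X" "y \<in> vcarrier X"
  shows "vnorm X x \<le> vnorm X (vdiff X x y) + vnorm X y"
proof -
  have "vnorm X x = vnorm X (vadd X (vdiff X x y) y)"
    using assms by (intro vnorm_cong) (simp add: algebra_simps)
  then show ?thesis
    using assms by (simp add: vnorm_triangle)
qed

lemma vnorm_diff_self [simp]: "x \<in> vcarrier X \<Longrightarrow> vnorm X (vdiff X x x) = 0"
  by (simp add: vnorm_def)

end

text \<open>Definiteness is stated as separation of points because the record has no zero vector.
  Through \<open>ip_eqI\<close> it takes over the role of the vector space laws.\<close>

locale definite_ip = semi_ip +
  assumes definite: "x \<in> vcarrier X \<Longrightarrow> y \<in> vcarrier X \<Longrightarrow> vnorm X (vdiff X x y) = 0 \<Longrightarrow> x = y"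
begin

lemma ip_eqI:
  assumes "x \<in> vcarrier X" "y \<in> vcarrier X" "\<And>z. z \<in> vcarrier X \<Longrightarrow> ip X x z = ip X y z"
  shows "x = y"
  using assms by (intro definite) (simp_all add: vnorm_def)

end

section \<open>Convergence in norm\<close>

definition vlim :: "'v ip_space \<Rightarrow> (nat \<Rightarrow> 'v) \<Rightarrow> 'v \<Rightarrow> bool" where
  "vlim X f x \<longleftrightarrow> (\<lambda>n. vnorm X (vdiff X (f n) x)) \<longlonglongrightarrow> 0"

context semi_ip
begin

lemma vlim_const: "x \<in> vcarrier X \<Longrightarrow> vlim X (\<lambda>_. x) x"
  by (simp add: vlim_def)

lemma vlim_ip:
  assumes f: "vlim X f x" "\<And>n. f n \<in> vcarrier X" "x \<in> vcarrier X"
    and g: "vlim X g y" "\<And>n. g n \<in> vcarrier X" "y \<in> vcarrier X"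
  shows "(\<lambda>n. ip X (f n) (g n)) \<longlonglongrightarrow> ip X x y"
proof -
  let ?u = "\<lambda>n. vnorm X (vdiff X (f n) x)" and ?v = "\<lambda>n. vnorm X (vdiff X (g n) y)"
  \<comment> \<open>The norm of \<open>g n\<close> is bounded by \<open>?v n + vnorm X y\<close>, so
    the estimate involves only null sequences and fixed norms.\<close>
  have "(\<lambda>n. ?u n * (?v n + vnorm X y) + vnorm X x * ?v n) \<longlonglongrightarrow> 0 * (0 + vnorm X y) + vnorm X x * 0"
    using f(1) g(1) unfolding vlim_def by (intro tendsto_intros)
  then have "(\<lambda>n. ?u n * (?v n + vnorm X y) + vnorm X x * ?v n) \<longlonglongrightarrow> 0"
    by simp
  moreover have "norm (ip X (f n) (g n) - ip X x y) \<le> ?u n * (?v n + vnorm X y) + vnorm X x * ?v n" for n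
  proof -
    have "ip X (f n) (g n) - ip X x y = ip X (vdiff X (f n) x) (g n) + ip X x (vdiff X (g n) y)"
      using f g by simp
    also have "norm \<dots> \<le> ?u n * vnorm X (g n) + vnorm X x * ?v n"
      using f g by (intro order_trans[OF norm_triangle_ineq] add_mono cauchy_schwarz) auto
    also have "\<dots> \<le> ?u n * (?v n + vnorm X y) + vnorm X x * ?v n"
      using f g by (intro add_mono mult_left_mono vnorm_le_diff) auto
    finally show ?thesis .
  qed
  ultimately have "(\<lambda>n. ip X (f n) (g n) - ip X x y) \<longlonglongrightarrow> 0"
    by (rule null_seq_le)
  then show ?thesis
    by (rule LIM_zero_cancel)
qed

lemma vlim_vnorm:
  assumes "vlim X f x" "\<And>n. f n \<in> vcarrier X" "x \<in> vcarrier X"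
  shows "(\<lambda>n. vnorm X (f n)) \<longlonglongrightarrow> vnorm X x"
  unfolding vnorm_def using vlim_ip[OF assms assms] by (intro tendsto_intros)

end

section \<open>Completion\<close>

context definite_ip
begin

lemma cauchy_seqs_iff:
  "f \<in> cauchy_seqs X \<longleftrightarrow> (\<forall>n. f n \<in> vcarrier X) \<and>
    (\<forall>e>0. \<exists>N. \<forall>m\<ge>N. \<forall>n\<ge>N. vnorm X (vdiff X (f m) (f n)) < e)"
  by (auto simp: cauchy_seqs_def)

lemma cauchy_seqs_closed: "f \<in> cauchy_seqs X \<Longrightarrow> f n \<in> vcarrier X"
  by (simp add: cauchy_seqs_iff)

lemma cauchy_seqs_const: "x \<in> vcarrier X \<Longrightarrow> (\<lambda>_. x) \<in> cauchy_seqs X"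
  by (simp add: cauchy_seqs_iff)

lemma cauchy_seqs_scale:
  assumes f: "f \<in> cauchy_seqs X"
  shows "(\<lambda>n. vscale X c (f n)) \<in> cauchy_seqs X"
  unfolding cauchy_seqs_iff
proof (intro conjI allI impI)
  note [simp] = cauchy_seqs_closed[OF f]
  show "vscale X c (f n) \<in> vcarrier X" for n
    by simp
  fix e :: real
  assume "e > 0"
  \<comment> \<open>The added 1 keeps the quotient meaningful for c = 0.\<close>
  then have "e / (cmod c + 1) > 0"
    by (simp add: add_nonneg_pos)
  then obtain N where N: "\<And>m n. m \<ge> N \<Longrightarrow> n \<ge> N \<Longrightarrow> vnorm X (vdiff X (f m) (f n)) < e / (cmod c + 1)"
    using f unfolding cauchy_seqs_iff by meson
  have "vnorm X (vdiff X (vscale X c (f m)) (vscale X c (f n))) < e" if "m \<ge> N" "n \<ge> N" for m n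
  proof -
    have "vnorm X (vdiff X (vscale X c (f m)) (vscale X c (f n))) =
        vnorm X (vscale X c (vdiff X (f m) (f n)))"
      by (intro vnorm_cong) (simp add: algebra_simps)
    also have "\<dots> = cmod c * vnorm X (vdiff X (f m) (f n))"
      by (simp add: vnorm_scale)
    also have "\<dots> \<le> (cmod c + 1) * vnorm X (vdiff X (f m) (f n))"
      by (intro mult_right_mono) auto
    also have "\<dots> < e"
      using N[OF that] by (simp add: pos_less_divide_eq add_nonneg_pos mult.commute)
    finally show ?thesis .
  qed
  then show "\<exists>N. \<forall>m\<ge>N. \<forall>n\<ge>N. vnorm X (vdiff X (vscale X c (f m)) (vscale X c (f n))) < e"
    by blast
qed

lemma vnorm_diff_add:
  assumes "x \<in> vcarrier X" "y \<in> vcarrier X" "x' \<in> vcarrier X" "y' \<in> vcarrier X"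
  shows "vnorm X (vdiff X (vadd X x y) (vadd X x' y')) \<le> vnorm X (vdiff X x x') + vnorm X (vdiff X y y')"
proof -
  have "vnorm X (vdiff X (vadd X x y) (vadd X x' y')) = vnorm X (vadd X (vdiff X x x') (vdiff X y y'))"
    using assms by (intro vnorm_cong) simp
  then show ?thesis
    using assms by (simp add: vnorm_triangle)
qed

lemma cauchy_seqs_add:
  assumes f: "f \<in> cauchy_seqs X" and g: "g \<in> cauchy_seqs X"
  shows "(\<lambda>n. vadd X (f n) (g n)) \<in> cauchy_seqs X"
  unfolding cauchy_seqs_iff
proof (intro conjI allI impI)
  note [simp] = cauchy_seqs_closed[OF f] cauchy_seqs_closed[OF g]
  show "vadd X (f n) (g n) \<in> vcarrier X" for n
    by simp
  fix e :: real
  assume "e > 0"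
  then have e: "e / 2 > 0"
    by simp
  obtain N where N: "\<And>m n. m \<ge> N \<Longrightarrow> n \<ge> N \<Longrightarrow> vnorm X (vdiff X (f m) (f n)) < e / 2"
    using f e unfolding cauchy_seqs_iff by meson
  obtain M where M: "\<And>m n. m \<ge> M \<Longrightarrow> n \<ge> M \<Longrightarrow> vnorm X (vdiff X (g m) (g n)) < e / 2"
    using g e unfolding cauchy_seqs_iff by meson
  have "vnorm X (vdiff X (vadd X (f m) (g m)) (vadd X (f n) (g n))) < e"
    if "m \<ge> max M N" "n \<ge> max M N" for m n
    using vnorm_diff_add[of "f m" "g m" "f n" "g n"] N[of m n] M[of m n] that by simp
  then show "\<exists>N. \<forall>m\<ge>N. \<forall>n\<ge>N. vnorm X (vdiff X (vadd X (f m) (g m)) (vadd X (f n) (g n))) < e"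
    by blast
qed

lemma cauchy_seqs_diff:
  "f \<in> cauchy_seqs X \<Longrightarrow> g \<in> cauchy_seqs X \<Longrightarrow> (\<lambda>n. vdiff X (f n) (g n)) \<in> cauchy_seqs X"
  unfolding vdiff_def by (intro cauchy_seqs_add cauchy_seqs_scale)

text \<open>The reverse triangle inequality makes the norms a Cauchy sequence of reals.\<close>

lemma cauchy_seqs_vnorm_convergent:
  assumes f: "f \<in> cauchy_seqs X"
  shows "convergent (\<lambda>n. vnorm X (f n))"
proof -
  note [simp] = cauchy_seqs_closed[OF f]
  have "\<bar>vnorm X (f m) - vnorm X (f n)\<bar> \<le> vnorm X (vdiff X (f m) (f n))" for m n
    using vnorm_le_diff[of "f m" "f n"] vnorm_le_diff[of "f n" "f m"]
      vnorm_diff_commute[of "f m" "f n"] by simp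
  then have "Cauchy (\<lambda>n. vnorm X (f n))"
    using f unfolding Cauchy_def dist_real_def cauchy_seqs_iff by (meson le_less_trans)
  then show ?thesis
    by (simp add: Cauchy_convergent_iff)
qed

text \<open>By polarisation, convergence of norms gives convergence of inner products.\<close>

lemma cauchy_seqs_ip_convergent:
  assumes f: "f \<in> cauchy_seqs X" and g: "g \<in> cauchy_seqs X"
  shows "convergent (\<lambda>n. ip X (f n) (g n))"
proof -
  note [simp] = cauchy_seqs_closed[OF f] cauchy_seqs_closed[OF g]
  have conv: "convergent (\<lambda>n. Re (c * ip X (f n) (g n)))" for c
  proof -
    let ?h = "\<lambda>n. vadd X (g n) (vscale X c (f n))"
    have h: "?h \<in> cauchy_seqs X"
      by (intro cauchy_seqs_add cauchy_seqs_scale f g)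
    have "Re (c * ip X (f n) (g n)) =
        ((vnorm X (?h n))\<^sup>2 - (vnorm X (g n))\<^sup>2 - (cmod c)\<^sup>2 * (vnorm X (f n))\<^sup>2) / 2" for n
      using vnorm_sq_add_scale[of "g n" "f n" c] by simp
    moreover obtain a b d where "(\<lambda>n. vnorm X (f n)) \<longlonglongrightarrow> a" "(\<lambda>n. vnorm X (g n)) \<longlonglongrightarrow> b"
        "(\<lambda>n. vnorm X (?h n)) \<longlonglongrightarrow> d"
      using f g h cauchy_seqs_vnorm_convergent unfolding convergent_def by meson
    then have "(\<lambda>n. ((vnorm X (?h n))\<^sup>2 - (vnorm X (g n))\<^sup>2 - (cmod c)\<^sup>2 * (vnorm X (f n))\<^sup>2) / 2)
        \<longlonglongrightarrow> (d\<^sup>2 - b\<^sup>2 - (cmod c)\<^sup>2 * a\<^sup>2) / 2"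
      by (intro tendsto_intros) simp_all
    ultimately show ?thesis
      by (simp only:) (rule convergentI)
  qed
  \<comment> \<open>The factor -i turns the imaginary part of the inner product into a real
    part.\<close>
  obtain a b where "(\<lambda>n. Re (ip X (f n) (g n))) \<longlonglongrightarrow> a" "(\<lambda>n. Im (ip X (f n) (g n))) \<longlonglongrightarrow> b"
    using conv[of 1] conv[of "- \<i>"] by (auto simp: convergent_def)
  then have "(\<lambda>n. ip X (f n) (g n)) \<longlonglongrightarrow> Complex a b"
    by (simp add: tendsto_complex_iff)
  then show ?thesis
    by (rule convergentI)
qed

section \<open>Cauchy sequences modulo null sequences\<close>

lemma cauchy_rel_iff:
  "(f, g) \<in> cauchy_rel X \<longleftrightarrow> f \<in> cauchy_seqs X \<and> g \<in> cauchy_seqs X \<and>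
    (\<lambda>n. vnorm X (vdiff X (f n) (g n))) \<longlonglongrightarrow> 0"
  by (simp add: cauchy_rel_def)

lemma equiv_cauchy_rel: "equiv (cauchy_seqs X) (cauchy_rel X)"
proof (rule equivI)
  show "cauchy_rel X \<subseteq> cauchy_seqs X \<times> cauchy_seqs X"
    by (auto simp: cauchy_rel_def)
  show "refl_on (cauchy_seqs X) (cauchy_rel X)"
    by (auto simp: refl_on_def cauchy_rel_iff cauchy_seqs_closed)
  show "sym (cauchy_rel X)"
    by (auto simp: sym_def cauchy_rel_iff cauchy_seqs_closed vnorm_diff_commute)
  show "trans (cauchy_rel X)"
  proof (rule transI)
    fix f g h
    assume fg: "(f, g) \<in> cauchy_rel X" and gh: "(g, h) \<in> cauchy_rel X"
    then have [simp]: "f n \<in> vcarrier X" "g n \<in> vcarrier X" "h n \<in> vcarrier X" for n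
      by (simp_all add: cauchy_rel_iff cauchy_seqs_closed)
    have "(\<lambda>n. vnorm X (vdiff X (f n) (g n)) + vnorm X (vdiff X (g n) (h n))) \<longlonglongrightarrow> 0"
      using fg gh unfolding cauchy_rel_iff by (intro tendsto_add_zero) auto
    then have "(\<lambda>n. vnorm X (vdiff X (f n) (h n))) \<longlonglongrightarrow> 0"
      by (rule null_seq_le) (simp add: vnorm_diff_triangle)
    then show "(f, h) \<in> cauchy_rel X"
      using fg gh by (simp add: cauchy_rel_iff)
  qed
qed

lemma cauchy_rel_cong:
  "(f, g) \<in> cauchy_rel X \<Longrightarrow> cauchy_rel X `` {f} = cauchy_rel X `` {g}"
  by (rule equiv_class_eq[OF equiv_cauchy_rel])

lemma cauchy_rel_add:
  assumes f: "(f, f') \<in> cauchy_rel X" and g: "(g, g') \<in> cauchy_rel X"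
  shows "(\<lambda>n. vadd X (f n) (g n), \<lambda>n. vadd X (f' n) (g' n)) \<in> cauchy_rel X"
proof -
  have [simp]: "f n \<in> vcarrier X" "g n \<in> vcarrier X" "f' n \<in> vcarrier X" "g' n \<in> vcarrier X" for n
    using f g by (simp_all add: cauchy_rel_iff cauchy_seqs_closed)
  have "(\<lambda>n. vnorm X (vdiff X (f n) (f' n)) + vnorm X (vdiff X (g n) (g' n))) \<longlonglongrightarrow> 0"
    using f g unfolding cauchy_rel_iff by (intro tendsto_add_zero) auto
  then have "(\<lambda>n. vnorm X (vdiff X (vadd X (f n) (g n)) (vadd X (f' n) (g' n)))) \<longlonglongrightarrow> 0"
    by (rule null_seq_le) (simp add: vnorm_diff_add)
  then show ?thesis
    using f g by (simp add: cauchy_rel_iff cauchy_seqs_add)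
qed

lemma cauchy_rel_scale:
  assumes f: "(f, f') \<in> cauchy_rel X"
  shows "(\<lambda>n. vscale X c (f n), \<lambda>n. vscale X c (f' n)) \<in> cauchy_rel X"
proof -
  have [simp]: "f n \<in> vcarrier X" "f' n \<in> vcarrier X" for n
    using f by (simp_all add: cauchy_rel_iff cauchy_seqs_closed)
  have "vnorm X (vdiff X (vscale X c (f n)) (vscale X c (f' n))) =
      vnorm X (vscale X c (vdiff X (f n) (f' n)))" for n
    by (intro vnorm_cong) (simp add: algebra_simps)
  then have *: "vnorm X (vdiff X (vscale X c (f n)) (vscale X c (f' n))) =
      cmod c * vnorm X (vdiff X (f n) (f' n))" for n
    by (simp add: vnorm_scale)
  show ?thesis
    using f by (simp add: cauchy_rel_iff cauchy_seqs_scale * tendsto_mult_right_zero)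
qed

text \<open>Independence of representatives, which makes the description of
  \<open>ip (completion X)\<close> unique. The norms of Cauchy sequences converge, so each summand
  of the estimate is a null sequence times a convergent one.\<close>

lemma cauchy_rel_ip:
  assumes f: "(f, f') \<in> cauchy_rel X" and g: "(g, g') \<in> cauchy_rel X"
    and lim: "(\<lambda>n. ip X (f n) (g n)) \<longlonglongrightarrow> z"
  shows "(\<lambda>n. ip X (f' n) (g' n)) \<longlonglongrightarrow> z"
proof -
  have [simp]: "f n \<in> vcarrier X" "g n \<in> vcarrier X" "f' n \<in> vcarrier X" "g' n \<in> vcarrier X" for n
    using f g by (simp_all add: cauchy_rel_iff cauchy_seqs_closed)
  let ?u = "\<lambda>n. vnorm X (vdiff X (f n) (f' n)) * vnorm X (g n) + vnorm X (f' n) * vnorm X (vdiff X (g n) (g' n))"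
  obtain a b where "(\<lambda>n. vnorm X (g n)) \<longlonglongrightarrow> a" "(\<lambda>n. vnorm X (f' n)) \<longlonglongrightarrow> b"
    using f g cauchy_seqs_vnorm_convergent unfolding cauchy_rel_iff convergent_def by meson
  then have "?u \<longlonglongrightarrow> 0 * a + b * 0"
    using f g unfolding cauchy_rel_iff by (intro tendsto_intros) auto
  then have u: "?u \<longlonglongrightarrow> 0"
    by simp
  have "norm (ip X (f n) (g n) - ip X (f' n) (g' n)) \<le> ?u n" for n
  proof -
    have "ip X (f n) (g n) - ip X (f' n) (g' n) =
        ip X (vdiff X (f n) (f' n)) (g n) + ip X (f' n) (vdiff X (g n) (g' n))"
      by simp
    also have "norm \<dots> \<le> ?u n"
      by (intro order_trans[OF norm_triangle_ineq] add_mono cauchy_schwarz) auto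
    finally show ?thesis .
  qed
  then have "(\<lambda>n. ip X (f n) (g n) - ip X (f' n) (g' n)) \<longlonglongrightarrow> 0"
    by (rule null_seq_le[OF u])
  then have "(\<lambda>n. ip X (f n) (g n) - (ip X (f n) (g n) - ip X (f' n) (g' n))) \<longlonglongrightarrow> z - 0"
    by (intro tendsto_diff lim)
  then show ?thesis
    by simp
qed

section \<open>Operations on classes and the embedding\<close>

abbreviation cauchy_class :: "(nat \<Rightarrow> 'a) \<Rightarrow> (nat \<Rightarrow> 'a) set" where
  "cauchy_class f \<equiv> cauchy_rel X `` {f}"

lemma cauchy_class_self: "f \<in> cauchy_seqs X \<Longrightarrow> f \<in> cauchy_class f"
  by (rule equiv_class_self[OF equiv_cauchy_rel])

lemma cauchy_class_closed: "f \<in> cauchy_seqs X \<Longrightarrow> cauchy_class f \<in> vcarrier (completion X)"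
  by (simp add: completion_def quotientI)

lemma cauchy_class_cases:
  assumes "A \<in> vcarrier (completion X)"
  obtains f where "f \<in> cauchy_seqs X" "A = cauchy_class f"
  using assms by (auto simp: completion_def elim: quotientE)

text \<open>The union over representatives in \<open>completion\<close> is a union of equal classes,
  by compatibility of addition with \<open>cauchy_rel\<close>, over a nonempty index set.\<close>

lemma completion_add:
  assumes "f \<in> cauchy_seqs X" "g \<in> cauchy_seqs X"
  shows "vadd (completion X) (cauchy_class f) (cauchy_class g) = cauchy_class (\<lambda>n. vadd X (f n) (g n))"
proof -
  have "cauchy_class (\<lambda>n. vadd X (f' n) (g' n)) = cauchy_class (\<lambda>n. vadd X (f n) (g n))"
    if "f' \<in> cauchy_class f" "g' \<in> cauchy_class g" for f' g'
    using that by (intro cauchy_rel_cong[symmetric] cauchy_rel_add) auto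
  then show ?thesis
    using cauchy_class_self[OF assms(1)] cauchy_class_self[OF assms(2)]
    unfolding completion_def by (simp (no_asm_simp)) blast
qed

lemma completion_scale:
  assumes "f \<in> cauchy_seqs X"
  shows "vscale (completion X) c (cauchy_class f) = cauchy_class (\<lambda>n. vscale X c (f n))"
proof -
  have "cauchy_class (\<lambda>n. vscale X c (f' n)) = cauchy_class (\<lambda>n. vscale X c (f n))"
    if "f' \<in> cauchy_class f" for f'
    using that by (intro cauchy_rel_cong[symmetric] cauchy_rel_scale) auto
  then show ?thesis
    using cauchy_class_self[OF assms]
    unfolding completion_def by (simp (no_asm_simp)) blast
qed

lemma completion_diff:
  "f \<in> cauchy_seqs X \<Longrightarrow> g \<in> cauchy_seqs X \<Longrightarrow>
    vdiff (completion X) (cauchy_class f) (cauchy_class g) = cauchy_class (\<lambda>n. vdiff X (f n) (g n))"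
  by (simp add: vdiff_def completion_add completion_scale cauchy_seqs_scale)

lemma completion_ip:
  assumes f: "f \<in> cauchy_seqs X" and g: "g \<in> cauchy_seqs X"
  shows "(\<lambda>n. ip X (f n) (g n)) \<longlonglongrightarrow> ip (completion X) (cauchy_class f) (cauchy_class g)"
proof -
  obtain z where z: "(\<lambda>n. ip X (f n) (g n)) \<longlonglongrightarrow> z"
    using cauchy_seqs_ip_convergent[OF f g] by (auto simp: convergent_def)
  have "ip (completion X) (cauchy_class f) (cauchy_class g) = z"
    unfolding completion_def ip_space.simps
  proof (rule the_equality)
    show "\<exists>f'\<in>cauchy_class f. \<exists>g'\<in>cauchy_class g. (\<lambda>n. ip X (f' n) (g' n)) \<longlonglongrightarrow> z"
      using z cauchy_class_self[OF f] cauchy_class_self[OF g] by blast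
    show "z' = z" if "\<exists>f'\<in>cauchy_class f. \<exists>g'\<in>cauchy_class g. (\<lambda>n. ip X (f' n) (g' n)) \<longlonglongrightarrow> z'" for z'
      using that cauchy_rel_ip[OF _ _ z] LIMSEQ_unique by blast
  qed
  then show ?thesis
    using z by simp
qed

lemma completion_vnorm:
  "f \<in> cauchy_seqs X \<Longrightarrow> (\<lambda>n. vnorm X (f n)) \<longlonglongrightarrow> vnorm (completion X) (cauchy_class f)"
  unfolding vnorm_def by (intro tendsto_intros completion_ip)

text \<open>Each law of the inner product is the limit of the same law for representatives.
  Definiteness holds because two sequences whose difference has norms tending to zero lie in the
  same class.\<close>

lemma definite_ip_completion: "definite_ip (completion X)"
proof
  let ?C = "completion X"
  show "vcarrier ?C \<noteq> {}"
    using nonempty cauchy_class_closed[OF cauchy_seqs_const] by blast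
  fix A B D c
  assume A: "A \<in> vcarrier ?C"
  obtain f where f: "f \<in> cauchy_seqs X" "A = cauchy_class f"
    by (rule cauchy_class_cases[OF A])
  note [simp] = cauchy_seqs_closed[OF f(1)]
  \<comment> \<open>Here the locally bound \<open>A\<close> is the scalar and \<open>c\<close> is
    the vector.\<close>
  show "vscale ?C A c \<in> vcarrier ?C" if "c \<in> vcarrier ?C" for A c
    using that by (elim cauchy_class_cases)
      (simp add: completion_scale cauchy_class_closed cauchy_seqs_scale)
  show "0 \<le> Re (ip ?C A A)"
    using tendsto_Re[OF completion_ip[OF f(1) f(1)]] unfolding f(2)
    by (rule LIMSEQ_le_const) (simp add: ip_nonneg)
  assume B: "B \<in> vcarrier ?C"
  obtain g where g: "g \<in> cauchy_seqs X" "B = cauchy_class g"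
    by (rule cauchy_class_cases[OF B])
  note [simp] = cauchy_seqs_closed[OF g(1)]
  show "vadd ?C A B \<in> vcarrier ?C"
    by (simp add: f g completion_add cauchy_class_closed cauchy_seqs_add)
  show "ip ?C (vscale ?C c A) B = c * ip ?C A B" for c
    using completion_ip[OF cauchy_seqs_scale[OF f(1), of c] g(1)]
      tendsto_mult_left[OF completion_ip[OF f(1) g(1)], of c]
    by (simp add: f g completion_scale LIMSEQ_unique)
  show "ip ?C B A = cnj (ip ?C A B)"
  proof (rule LIMSEQ_unique)
    show "(\<lambda>n. ip X (g n) (f n)) \<longlonglongrightarrow> ip ?C B A"
      unfolding f g using f g by (intro completion_ip)
    show "(\<lambda>n. ip X (g n) (f n)) \<longlonglongrightarrow> cnj (ip ?C A B)"
      unfolding f g ip_cnj[OF cauchy_seqs_closed[OF f(1)] cauchy_seqs_closed[OF g(1)]]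
      using f g by (intro tendsto_cnj completion_ip)
  qed
  show "A = B" if "vnorm ?C (vdiff ?C A B) = 0"
  proof -
    have "(\<lambda>n. vnorm X (vdiff X (f n) (g n))) \<longlonglongrightarrow> 0"
      using completion_vnorm[OF cauchy_seqs_diff[OF f(1) g(1)]] that
      by (simp add: f g completion_diff)
    then show ?thesis
      unfolding f g using f g by (intro cauchy_rel_cong) (simp add: cauchy_rel_iff)
  qed
  assume D: "D \<in> vcarrier ?C"
  obtain h where h: "h \<in> cauchy_seqs X" "D = cauchy_class h"
    by (rule cauchy_class_cases[OF D])
  note [simp] = cauchy_seqs_closed[OF h(1)]
  show "ip ?C (vadd ?C A B) D = ip ?C A D + ip ?C B D"
    using completion_ip[OF cauchy_seqs_add[OF f(1) g(1)] h(1)]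
      tendsto_add[OF completion_ip[OF f(1) h(1)] completion_ip[OF g(1) h(1)]]
    by (simp add: f g h completion_add LIMSEQ_unique)
qed

lemma embed_closed: "x \<in> vcarrier X \<Longrightarrow> embed X x \<in> vcarrier (completion X)"
  unfolding embed_def by (intro cauchy_class_closed cauchy_seqs_const)

lemma embed_add:
  "x \<in> vcarrier X \<Longrightarrow> y \<in> vcarrier X \<Longrightarrow>
    embed X (vadd X x y) = vadd (completion X) (embed X x) (embed X y)"
  unfolding embed_def by (simp add: completion_add cauchy_seqs_const)

lemma embed_scale:
  "x \<in> vcarrier X \<Longrightarrow> embed X (vscale X c x) = vscale (completion X) c (embed X x)"
  unfolding embed_def by (simp add: completion_scale cauchy_seqs_const)

lemma ip_embed:
  "x \<in> vcarrier X \<Longrightarrow> y \<in> vcarrier X \<Longrightarrow> ip (completion X) (embed X x) (embed X y) = ip X x y"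
  unfolding embed_def
  using completion_ip[OF cauchy_seqs_const cauchy_seqs_const, of x y] LIMSEQ_unique tendsto_const
  by blast

text \<open>This yields both density of the embedded space and a limit for every Cauchy sequence
  coming from it. The distance from \<open>embed X (f n)\<close> to the class is the limit over m of
  the norms of \<open>vdiff X (f n) (f m)\<close>; passing to the limit loses strictness, hence the
  bound e / 2.\<close>

lemma vlim_embed:
  assumes f: "f \<in> cauchy_seqs X"
  shows "vlim (completion X) (\<lambda>n. embed X (f n)) (cauchy_class f)"
  unfolding vlim_def
proof (rule LIMSEQ_I)
  fix e :: real
  assume "e > 0"
  then have "e / 2 > 0"
    by simp
  then obtain N where N: "\<And>m n. m \<ge> N \<Longrightarrow> n \<ge> N \<Longrightarrow> vnorm X (vdiff X (f m) (f n)) < e / 2"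
    using f unfolding cauchy_seqs_iff by meson
  interpret C: definite_ip "completion X"
    by (rule definite_ip_completion)
  note fn = cauchy_seqs_const[OF cauchy_seqs_closed[OF f]]
  have "norm (vnorm (completion X) (vdiff (completion X) (embed X (f n)) (cauchy_class f)) - 0) < e"
    if "n \<ge> N" for n
  proof -
    let ?d = "vnorm (completion X) (vdiff (completion X) (embed X (f n)) (cauchy_class f))"
    have "?d = vnorm (completion X) (cauchy_class (\<lambda>m. vdiff X (f n) (f m)))"
      unfolding embed_def by (simp add: completion_diff f fn)
    then have "(\<lambda>m. vnorm X (vdiff X (f n) (f m))) \<longlonglongrightarrow> ?d"
      using completion_vnorm[OF cauchy_seqs_diff[OF fn[of n] f]] by simp
    then have "?d \<le> e / 2"
      using N[OF that] by (intro LIMSEQ_le_const2) (auto intro!: exI[of _ N] less_imp_le)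
    moreover have "0 \<le> ?d"
      by (simp add: embed_closed cauchy_class_closed cauchy_seqs_closed f)
    ultimately show ?thesis
      using \<open>e > 0\<close> by simp
  qed
  then show "\<exists>N. \<forall>n\<ge>N. norm (vnorm (completion X) (vdiff (completion X) (embed X (f n)) (cauchy_class f)) - 0) < e"
    by blast
qed

end

section \<open>Bounded operators\<close>

lemma bounded_opsD:
  assumes "A \<in> bounded_ops X Y"
  shows "x \<in> vcarrier X \<Longrightarrow> A x \<in> vcarrier Y"
    and "x \<in> vcarrier X \<Longrightarrow> y \<in> vcarrier X \<Longrightarrow> A (vadd X x y) = vadd Y (A x) (A y)"
    and "x \<in> vcarrier X \<Longrightarrow> A (vscale X c x) = vscale Y c (A x)"
    and "x \<notin> vcarrier X \<Longrightarrow> A x = undefined"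
  using assms by (auto simp: bounded_ops_def)

lemma bounded_ops_bound:
  assumes "A \<in> bounded_ops X Y"
  obtains C where "\<And>x. x \<in> vcarrier X \<Longrightarrow> vnorm Y (A x) \<le> C * vnorm X x"
  using assms unfolding bounded_ops_def by blast

lemma bounded_opsI:
  assumes "\<And>x. x \<in> vcarrier X \<Longrightarrow> A x \<in> vcarrier Y"
    and "\<And>x. x \<notin> vcarrier X \<Longrightarrow> A x = undefined"
    and "\<And>x y. x \<in> vcarrier X \<Longrightarrow> y \<in> vcarrier X \<Longrightarrow> A (vadd X x y) = vadd Y (A x) (A y)"
    and "\<And>c x. x \<in> vcarrier X \<Longrightarrow> A (vscale X c x) = vscale Y c (A x)"
    and "\<And>x. x \<in> vcarrier X \<Longrightarrow> vnorm Y (A x) \<le> C * vnorm X x"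
  shows "A \<in> bounded_ops X Y"
proof -
  have "\<exists>C. \<forall>x\<in>vcarrier X. vnorm Y (A x) \<le> C * vnorm X x"
    using assms(5) by blast
  then show ?thesis
    using assms(1-4) unfolding bounded_ops_def by (simp add: PiE_iff extensional_def)
qed

lemma bounded_ops_diff:
  assumes "A \<in> bounded_ops X Y" "semi_ip X" "x \<in> vcarrier X" "y \<in> vcarrier X"
  shows "A (vdiff X x y) = vdiff Y (A x) (A y)"
  using assms semi_ip.scale_closed[OF assms(2)]
  by (simp add: vdiff_def bounded_opsD[OF assms(1)])

lemma bounded_ops_vlim:
  assumes A: "A \<in> bounded_ops X Y" and X: "semi_ip X" and Y: "semi_ip Y"
    and f: "\<And>n. f n \<in> vcarrier X" "x \<in> vcarrier X" "vlim X f x"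
  shows "vlim Y (\<lambda>n. A (f n)) (A x)"
proof -
  interpret X: semi_ip X by fact
  interpret Y: semi_ip Y by fact
  obtain C where C: "\<And>x. x \<in> vcarrier X \<Longrightarrow> vnorm Y (A x) \<le> C * vnorm X x"
    using bounded_ops_bound[OF A] by blast
  have "(\<lambda>n. C * vnorm X (vdiff X (f n) x)) \<longlonglongrightarrow> 0"
    using f unfolding vlim_def by (intro tendsto_mult_right_zero)
  moreover have "norm (vnorm Y (vdiff Y (A (f n)) (A x))) \<le> C * vnorm X (vdiff X (f n) x)" for n
    using C[of "vdiff X (f n) x"] f bounded_ops_diff[OF A X f(1) f(2)]
    by (simp add: bounded_opsD[OF A])
  ultimately show ?thesis
    unfolding vlim_def by (rule null_seq_le)
qed

lemma (in definite_ip) vlim_unique: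
  assumes "vlim X f x" "vlim X f y" "\<And>n. f n \<in> vcarrier X" "x \<in> vcarrier X" "y \<in> vcarrier X"
  shows "x = y"
proof (rule ip_eqI)
  show "ip X x z = ip X y z" if z: "z \<in> vcarrier X" for z
    using LIMSEQ_unique[OF vlim_ip[OF assms(1,3,4) vlim_const[OF z] z z]
        vlim_ip[OF assms(2,3,5) vlim_const[OF z] z z]] .
qed (fact assms)+

text \<open>The source of uniqueness in the descriptions \<open>repr_op\<close> and
  \<open>extend_op\<close>. Off the carrier both operators are \<open>undefined\<close>, so
  agreement on the carrier is equality of functions.\<close>

lemma bounded_ops_eqI_dense:
  assumes A: "A \<in> bounded_ops X Y" and B: "B \<in> bounded_ops X Y"
    and X: "semi_ip X" and Y: "definite_ip Y"
    and S: "S \<subseteq> vcarrier X" and eq: "\<And>x. x \<in> S \<Longrightarrow> A x = B x"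
    and dense: "\<And>x. x \<in> vcarrier X \<Longrightarrow> \<exists>f. (\<forall>n. f n \<in> S) \<and> vlim X f x"
  shows "A = B"
proof
  fix x
  interpret Y: definite_ip Y by fact
  show "A x = B x"
  proof (cases "x \<in> vcarrier X")
    case True
    then obtain f where f: "\<And>n. f n \<in> S" "vlim X f x"
      using dense by blast
    then have [simp]: "f n \<in> vcarrier X" for n
      using S by blast
    have "vlim Y (\<lambda>n. A (f n)) (A x)"
      using f True by (intro bounded_ops_vlim[OF A X Y.semi_ip_axioms]) auto
    moreover have "vlim Y (\<lambda>n. A (f n)) (B x)"
      unfolding eq[OF f(1)] using f True by (intro bounded_ops_vlim[OF B X Y.semi_ip_axioms]) auto
    ultimately show ?thesis
      using True bounded_opsD(1)[OF A] bounded_opsD(1)[OF B]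
      by (intro Y.vlim_unique[of "\<lambda>n. A (f n)"]) auto
  qed (simp add: bounded_opsD(4)[OF A] bounded_opsD(4)[OF B])
qed

section \<open>Products of spaces and the algebra of bounded operators\<close>

lemma definite_ip_prod:
  assumes "definite_ip X" "definite_ip Y"
  shows "definite_ip (ip_prod X Y)"
proof -
  interpret X: definite_ip X by fact
  interpret Y: definite_ip Y by fact
  show ?thesis
  proof
    show "vcarrier (ip_prod X Y) \<noteq> {}"
      using X.nonempty Y.nonempty by (simp add: ip_prod_def)
    fix x y
    assume x: "x \<in> vcarrier (ip_prod X Y)" and y: "y \<in> vcarrier (ip_prod X Y)"
    show "ip (ip_prod X Y) y x = cnj (ip (ip_prod X Y) x y)"
      using x y X.ip_cnj[of "fst x" "fst y"] Y.ip_cnj[of "snd x" "snd y"]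
      by (auto simp: ip_prod_def)
    show "x = y" if 0: "vnorm (ip_prod X Y) (vdiff (ip_prod X Y) x y) = 0"
    proof -
      obtain a b where x': "x = (a, b)" "a \<in> vcarrier X" "b \<in> vcarrier Y"
        using x by (auto simp: ip_prod_def)
      obtain a' b' where y': "y = (a', b')" "a' \<in> vcarrier X" "b' \<in> vcarrier Y"
        using y by (auto simp: ip_prod_def)
      have "(vnorm X (vdiff X a a'))\<^sup>2 + (vnorm Y (vdiff Y b b'))\<^sup>2 = 0"
        using 0 x' y' unfolding X.vnorm_sq[OF X.diff_closed[OF x'(2) y'(2)]]
          Y.vnorm_sq[OF Y.diff_closed[OF x'(3) y'(3)]]
        by (simp add: vnorm_def ip_prod_def vdiff_def)
      then show ?thesis
        using x' y' X.definite[of a a'] Y.definite[of b b'] by (simp add: sum_power2_eq_zero_iff)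
    qed
  qed (auto simp: ip_prod_def X.ip_nonneg Y.ip_nonneg algebra_simps)
qed

lemma vlim_prod:
  assumes "definite_ip X" "definite_ip Y"
    and f: "vlim X f x" "\<And>n. f n \<in> vcarrier X" "x \<in> vcarrier X"
    and g: "vlim Y g y" "\<And>n. g n \<in> vcarrier Y" "y \<in> vcarrier Y"
  shows "vlim (ip_prod X Y) (\<lambda>n. (f n, g n)) (x, y)"
proof -
  interpret X: definite_ip X by fact
  interpret Y: definite_ip Y by fact
  let ?u = "\<lambda>n. vnorm X (vdiff X (f n) x)" and ?v = "\<lambda>n. vnorm Y (vdiff Y (g n) y)"
  have "vnorm (ip_prod X Y) (vdiff (ip_prod X Y) (f n, g n) (x, y)) = sqrt ((?u n)\<^sup>2 + (?v n)\<^sup>2)" for n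
    unfolding X.vnorm_sq[OF X.diff_closed[OF f(2,3)]] Y.vnorm_sq[OF Y.diff_closed[OF g(2,3)]]
    by (simp add: vnorm_def ip_prod_def vdiff_def)
  moreover have "(\<lambda>n. sqrt ((?u n)\<^sup>2 + (?v n)\<^sup>2)) \<longlonglongrightarrow> sqrt (0\<^sup>2 + 0\<^sup>2)"
    using f(1) g(1) unfolding vlim_def by (intro tendsto_intros)
  ultimately show ?thesis
    by (simp add: vlim_def)
qed

lemma bounded_ops_compose:
  assumes A: "A \<in> bounded_ops X Y" and B: "B \<in> bounded_ops Y Z" and X: "semi_ip X" and Y: "semi_ip Y"
  shows "(\<lambda>x\<in>vcarrier X. B (A x)) \<in> bounded_ops X Z"
proof -
  interpret X: semi_ip X by fact
  interpret Y: semi_ip Y by fact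
  obtain C where C: "\<And>x. x \<in> vcarrier X \<Longrightarrow> vnorm Y (A x) \<le> C * vnorm X x"
    using bounded_ops_bound[OF A] by blast
  obtain D where D: "\<And>x. x \<in> vcarrier Y \<Longrightarrow> vnorm Z (B x) \<le> D * vnorm Y x"
    using bounded_ops_bound[OF B] by blast
  note [simp] = bounded_opsD(1-3)[OF A] bounded_opsD(1-3)[OF B]
  show ?thesis
  \<comment> \<open>A bounding constant in \<open>bounded_ops\<close> carries no sign, and
    multiplying the estimate for \<open>A\<close> by it requires the absolute value.\<close>
  proof (rule bounded_opsI[where C = "\<bar>D\<bar> * C"])
    fix x
    assume x: "x \<in> vcarrier X"
    have "vnorm Z (B (A x)) \<le> D * vnorm Y (A x)"
      using x D by simp
    also have "\<dots> \<le> \<bar>D\<bar> * vnorm Y (A x)"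
      using x by (intro mult_right_mono) auto
    also have "\<dots> \<le> \<bar>D\<bar> * (C * vnorm X x)"
      using x C by (intro mult_left_mono) auto
    finally show "vnorm Z ((\<lambda>x\<in>vcarrier X. B (A x)) x) \<le> \<bar>D\<bar> * C * vnorm X x"
      using x by (simp add: mult.assoc)
  qed auto
qed

text \<open>Definiteness of the target enters because linearity of the sum rearranges vectors of
  \<open>Y\<close>, which is justified by \<open>ip_eqI\<close>.\<close>

lemma bounded_ops_add:
  assumes A: "A \<in> bounded_ops X Y" and B: "B \<in> bounded_ops X Y" and X: "semi_ip X" and Y: "definite_ip Y"
  shows "(\<lambda>x\<in>vcarrier X. vadd Y (A x) (B x)) \<in> bounded_ops X Y"
proof -
  interpret X: semi_ip X by fact
  interpret Y: definite_ip Y by fact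
  obtain C where C: "\<And>x. x \<in> vcarrier X \<Longrightarrow> vnorm Y (A x) \<le> C * vnorm X x"
    using bounded_ops_bound[OF A] by blast
  obtain D where D: "\<And>x. x \<in> vcarrier X \<Longrightarrow> vnorm Y (B x) \<le> D * vnorm X x"
    using bounded_ops_bound[OF B] by blast
  note [simp] = bounded_opsD(1-3)[OF A] bounded_opsD(1-3)[OF B]
  show ?thesis
  proof (rule bounded_opsI[where C = "C + D"])
    fix x c
    assume x: "x \<in> vcarrier X"
    then show "vnorm Y ((\<lambda>x\<in>vcarrier X. vadd Y (A x) (B x)) x) \<le> (C + D) * vnorm X x"
      using Y.vnorm_triangle[of "A x" "B x"] C[of x] D[of x] by (simp add: distrib_right)
    show "(\<lambda>x\<in>vcarrier X. vadd Y (A x) (B x)) (vscale X c x) =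
        vscale Y c ((\<lambda>x\<in>vcarrier X. vadd Y (A x) (B x)) x)"
      using x by (simp, intro Y.ip_eqI) (auto simp: algebra_simps)
    fix y
    assume y: "y \<in> vcarrier X"
    show "(\<lambda>x\<in>vcarrier X. vadd Y (A x) (B x)) (vadd X x y) =
        vadd Y ((\<lambda>x\<in>vcarrier X. vadd Y (A x) (B x)) x) ((\<lambda>x\<in>vcarrier X. vadd Y (A x) (B x)) y)"
      using x y by (simp, intro Y.ip_eqI) auto
  qed auto
qed

lemma bounded_ops_scale:
  assumes A: "A \<in> bounded_ops X Y" and X: "semi_ip X" and Y: "definite_ip Y"
  shows "(\<lambda>x\<in>vcarrier X. vscale Y c (A x)) \<in> bounded_ops X Y"
proof -
  interpret X: semi_ip X by fact
  interpret Y: definite_ip Y by fact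
  obtain C where C: "\<And>x. x \<in> vcarrier X \<Longrightarrow> vnorm Y (A x) \<le> C * vnorm X x"
    using bounded_ops_bound[OF A] by blast
  note [simp] = bounded_opsD(1-3)[OF A]
  show ?thesis
  proof (rule bounded_opsI[where C = "cmod c * C"])
    fix x a
    assume x: "x \<in> vcarrier X"
    then show "vnorm Y ((\<lambda>x\<in>vcarrier X. vscale Y c (A x)) x) \<le> cmod c * C * vnorm X x"
      using C[of x] by (simp add: Y.vnorm_scale mult.assoc mult_left_mono)
    show "(\<lambda>x\<in>vcarrier X. vscale Y c (A x)) (vscale X a x) =
        vscale Y a ((\<lambda>x\<in>vcarrier X. vscale Y c (A x)) x)"
      using x by (simp, intro Y.ip_eqI) auto
    fix y
    assume y: "y \<in> vcarrier X"
    show "(\<lambda>x\<in>vcarrier X. vscale Y c (A x)) (vadd X x y) =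
        vadd Y ((\<lambda>x\<in>vcarrier X. vscale Y c (A x)) x) ((\<lambda>x\<in>vcarrier X. vscale Y c (A x)) y)"
      using x y by (simp, intro Y.ip_eqI) (auto simp: algebra_simps)
  qed auto
qed

lemma ip_prod_simps:
  "vcarrier (ip_prod X Y) = vcarrier X \<times> vcarrier Y"
  "vadd (ip_prod X Y) (a, b) (a', b') = (vadd X a a', vadd Y b b')"
  "vscale (ip_prod X Y) c (a, b) = (vscale X c a, vscale Y c b)"
  "ip (ip_prod X Y) (a, b) (a', b') = ip X a a' + ip Y b b'"
  by (simp_all add: ip_prod_def)

lemma vdiff_ip_prod: "vdiff (ip_prod X Y) (a, b) (a', b') = (vdiff X a a', vdiff Y b b')"
  by (simp add: vdiff_def ip_prod_simps)

lemma bounded_ops_fst: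
  assumes "semi_ip X" "semi_ip Y"
  shows "restrict fst (vcarrier (ip_prod X Y)) \<in> bounded_ops (ip_prod X Y) X"
proof -
  interpret X: semi_ip X by fact
  interpret Y: semi_ip Y by fact
  show ?thesis
    by (rule bounded_opsI[where C = 1])
      (auto simp: ip_prod_simps vnorm_def intro!: real_sqrt_le_mono Y.ip_nonneg)
qed

lemma bounded_ops_snd:
  assumes "semi_ip X" "semi_ip Y"
  shows "restrict snd (vcarrier (ip_prod X Y)) \<in> bounded_ops (ip_prod X Y) Y"
proof -
  interpret X: semi_ip X by fact
  interpret Y: semi_ip Y by fact
  show ?thesis
    by (rule bounded_opsI[where C = 1])
      (auto simp: ip_prod_simps vnorm_def intro!: real_sqrt_le_mono X.ip_nonneg)
qed

lemma bounded_ops_pair: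
  assumes A: "A \<in> bounded_ops X Y" and B: "B \<in> bounded_ops X Z"
    and X: "semi_ip X" and Y: "semi_ip Y" and Z: "semi_ip Z"
  shows "(\<lambda>x\<in>vcarrier X. (A x, B x)) \<in> bounded_ops X (ip_prod Y Z)"
proof -
  interpret X: semi_ip X by fact
  interpret Y: semi_ip Y by fact
  interpret Z: semi_ip Z by fact
  obtain C where C: "\<And>x. x \<in> vcarrier X \<Longrightarrow> vnorm Y (A x) \<le> C * vnorm X x"
    using bounded_ops_bound[OF A] by blast
  obtain D where D: "\<And>x. x \<in> vcarrier X \<Longrightarrow> vnorm Z (B x) \<le> D * vnorm X x"
    using bounded_ops_bound[OF B] by blast
  note [simp] = bounded_opsD(1-3)[OF A] bounded_opsD(1-3)[OF B]
  show ?thesis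
  proof (rule bounded_opsI[where C = "C + D"])
    fix x
    assume x: "x \<in> vcarrier X"
    have "vnorm (ip_prod Y Z) (A x, B x) = sqrt ((vnorm Y (A x))\<^sup>2 + (vnorm Z (B x))\<^sup>2)"
      using x by (simp add: Y.vnorm_sq Z.vnorm_sq) (simp add: vnorm_def ip_prod_simps)
    also have "\<dots> \<le> vnorm Y (A x) + vnorm Z (B x)"
      using x by (intro sqrt_sum_squares_le_sum) auto
    also have "\<dots> \<le> (C + D) * vnorm X x"
      using x C[of x] D[of x] by (simp add: distrib_right)
    finally show "vnorm (ip_prod Y Z) ((\<lambda>x\<in>vcarrier X. (A x, B x)) x) \<le> (C + D) * vnorm X x"
      using x by simp
  qed (auto simp: ip_prod_simps)
qed

section \<open>Recognising adjoints and orthogonal projections\<close>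

lemma adjoint_op_eqI:
  assumes X: "definite_ip X"
    and B: "B \<in> bounded_ops Y X"
    and adj: "\<And>x y. x \<in> vcarrier X \<Longrightarrow> y \<in> vcarrier Y \<Longrightarrow> ip Y (A x) y = ip X x (B y)"
  shows "adjoint_op X Y A = B"
  unfolding adjoint_op_def
proof (rule the_equality)
  interpret X: definite_ip X by fact
  fix B'
  assume B': "B' \<in> bounded_ops Y X \<and> (\<forall>x\<in>vcarrier X. \<forall>y\<in>vcarrier Y. ip Y (A x) y = ip X x (B' y))"
  show "B' = B"
  proof
    fix y
    show "B' y = B y"
    proof (cases "y \<in> vcarrier Y")
      case True
      then have cl: "B' y \<in> vcarrier X" "B y \<in> vcarrier X"
        using bounded_opsD(1)[OF B True] bounded_opsD(1)[OF conjunct1[OF B'] True] by simp_all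
      show ?thesis
      proof (rule X.ip_eqI[OF cl])
        fix z
        assume z: "z \<in> vcarrier X"
        then have "ip X z (B' y) = ip X z (B y)"
          using conjunct2[OF B'] adj[OF z True] True by simp
        then show "ip X (B' y) z = ip X (B y) z"
          using X.ip_cnj[OF z cl(1)] X.ip_cnj[OF z cl(2)] by simp
      qed
    next
      case False
      then show ?thesis
        by (simp add: bounded_opsD(4)[OF B] bounded_opsD(4)[OF conjunct1[OF B']])
    qed
  qed
qed (use B adj in auto)

text \<open>Existence is supplied as the witness \<open>p\<close>. A second candidate
  \<open>q\<close> has the same inner products with the elements of \<open>M\<close>. As
  \<open>M\<close> is merely a set, the difference of \<open>p\<close> and \<open>q\<close> need not
  lie in it, so one tests with \<open>p\<close> and with \<open>q\<close> separately and combines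
  the results.\<close>

lemma ortho_proj_eqI:
  assumes X: "definite_ip X" and M: "M \<subseteq> vcarrier X" and x: "x \<in> vcarrier X"
    and p: "p \<in> M" "vdiff X x p \<in> ortho_compl X M"
  shows "ortho_proj X M x = p"
proof -
  interpret X: definite_ip X by fact
  have "q = p" if q: "q \<in> M" "vdiff X x q \<in> ortho_compl X M" for q
  proof -
    have [simp]: "p \<in> vcarrier X" "q \<in> vcarrier X"
      using p q M by auto
    have "ip X x z = ip X p z" "ip X x z = ip X q z" if "z \<in> M" for z
      using p(2) q(2) that M x unfolding ortho_compl_def by (auto simp: subset_iff)
    then have "ip X p p = ip X q p" "ip X p q = ip X q q"
      using p q by metis+
    then show ?thesis
      by (intro X.definite) (simp_all add: vnorm_def)
  qed
  then have "(THE q. q \<in> M \<and> vdiff X x q \<in> ortho_compl X M) = p"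
    using p by blast
  then show ?thesis
    using x by (simp add: ortho_proj_def)
qed

section \<open>The Hilbert space of a form\<close>

text \<open>Views the vector space with its possibly degenerate form as a \<open>semi_ip\<close>, to
  have Cauchy-Schwarz for \<open>t\<close>.\<close>

definition form_space ::
    "(complex \<Rightarrow> 'a::ab_group_add \<Rightarrow> 'a) \<Rightarrow> ('a \<Rightarrow> 'a \<Rightarrow> complex) \<Rightarrow> 'a ip_space" where
  "form_space s t = \<lparr>vcarrier = UNIV, vadd = (+), vscale = s, ip = t\<rparr>"

locale herm_form =
  fixes s :: "complex \<Rightarrow> 'a::ab_group_add \<Rightarrow> 'a" and t :: "'a \<Rightarrow> 'a \<Rightarrow> complex"
  assumes vs: "vector_space s" and form: "nonneg_form s t"
begin

interpretation vector_space s
  by (rule vs)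

lemma form_add: "t (x + y) z = t x z + t y z"
  using form by (simp add: nonneg_form_def Vector_Spaces.linear_iff)

lemma form_scale: "t (s c x) z = c * t x z"
  using form by (simp add: nonneg_form_def Vector_Spaces.linear_iff)

lemma form_add_right: "t z (x + y) = t z x + t z y"
proof -
  have "cnj (t z (x + y)) = cnj (t z x) + cnj (t z y)"
    using form by (simp add: nonneg_form_def Vector_Spaces.linear_iff)
  then show ?thesis
    by (metis complex_cnj_add complex_cnj_cancel_iff)
qed

lemma form_scale_right: "t z (s c x) = cnj c * t z x"
proof -
  have "cnj (t z (s c x)) = c * cnj (t z x)"
    using form by (simp add: nonneg_form_def Vector_Spaces.linear_iff)
  then show ?thesis
    by (metis complex_cnj_mult complex_cnj_cnj)
qed

lemma form_self: "0 \<le> Re (t x x)" "Im (t x x) = 0"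
  using form by (auto simp: nonneg_form_def complex_nonneg_Reals_iff)

text \<open>Hermitian symmetry follows from reality of the diagonal: the vector x + y settles the
  imaginary parts, and x + i y the real parts.\<close>

lemma form_cnj: "t y x = cnj (t x y)"
proof -
  have "Im (t (x + y) (x + y)) = 0" "Im (t (x + s \<i> y) (x + s \<i> y)) = 0"
    by (rule form_self)+
  then show ?thesis
    by (simp add: form_add form_add_right form_scale form_scale_right form_self complex_eq_iff)
qed

lemma scale_minus_one: "s (- 1) x = - x"
  using scale_minus_left[of 1 x] by simp

lemma form_diff: "t (x - y) z = t x z - t y z"
  using form_add[of x "- y" z] form_scale[of "- 1" y z] by (simp add: scale_minus_one)

lemma form_diff_right: "t z (x - y) = t z x - t z y"
  using form_add_right[of z x "- y"] form_scale_right[of z "- 1" y] by (simp add: scale_minus_one)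

lemma semi_ip_form_space: "semi_ip (form_space s t)"
  by unfold_locales
    (auto simp: form_space_def form_add form_scale form_self intro: form_cnj)

text \<open>By Cauchy-Schwarz an isotropic vector is orthogonal to everything. Hence
  \<open>null_space t\<close> is the radical of the form, and the form descends to cosets.\<close>

lemma null_space_iff: "x \<in> null_space t \<longleftrightarrow> (\<forall>y. t x y = 0)"
proof -
  have "t x y = 0" if "t x x = 0" for y
    using semi_ip.cauchy_schwarz[OF semi_ip_form_space, of x y] that
    by (simp add: form_space_def vnorm_def)
  then show ?thesis
    by (auto simp: null_space_def)
qed

text \<open>Replaces coset arithmetic by equations between the functionals \<open>t u\<close> and
  \<open>t x\<close>.\<close>

lemma mem_coset_iff: "u \<in> x +o null_space t \<longleftrightarrow> (\<forall>z. t u z = t x z)"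
proof
  assume "u \<in> x +o null_space t"
  then show "\<forall>z. t u z = t x z"
    by (auto simp: elt_set_plus_def null_space_iff form_add)
next
  assume "\<forall>z. t u z = t x z"
  then have "u - x \<in> null_space t" "u = x + (u - x)"
    by (simp_all add: null_space_iff form_diff)
  then show "u \<in> x +o null_space t"
    unfolding elt_set_plus_def by blast
qed

lemma coset_eq: "x +o null_space t = {u. \<forall>z. t u z = t x z}"
  by (auto simp: mem_coset_iff)

lemma quotient_add: "(x +o null_space t) + (y +o null_space t) = (x + y) +o null_space t"
proof (intro equalityI subsetI)
  fix u
  assume "u \<in> (x + y) +o null_space t"
  then have "u - x \<in> y +o null_space t" "u = x + (u - x)"
    by (simp_all add: mem_coset_iff form_add form_diff)
  moreover have "x \<in> x +o null_space t"
    by (simp add: mem_coset_iff)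
  ultimately show "u \<in> (x +o null_space t) + (y +o null_space t)"
    unfolding set_plus_def by blast
qed (auto simp: coset_eq set_plus_def form_add)

lemma quotient_scale: "s c ` (x +o null_space t) + null_space t = s c x +o null_space t"
proof (intro equalityI subsetI)
  fix u
  assume "u \<in> s c x +o null_space t"
  then have "u - s c x \<in> null_space t" "u = s c x + (u - s c x)"
    by (simp_all add: mem_coset_iff null_space_iff form_diff)
  moreover have "s c x \<in> s c ` (x +o null_space t)"
    by (rule imageI) (simp add: mem_coset_iff)
  ultimately show "u \<in> s c ` (x +o null_space t) + null_space t"
    unfolding set_plus_def by blast
qed (auto simp: mem_coset_iff null_space_iff set_plus_def form_add form_scale)

lemma quotient_ip: "ip (quotient_space s t) (x +o null_space t) (y +o null_space t) = t x y"
proof -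
  have "t u v = t x y" if "u \<in> x +o null_space t" "v \<in> y +o null_space t" for u v
    using that form_cnj[of x v] form_cnj[of x y] by (simp add: mem_coset_iff)
  moreover have "z \<in> z +o null_space t" for z
    by (simp add: mem_coset_iff)
  ultimately show ?thesis
    unfolding quotient_space_def ip_space.simps by (intro the_equality) blast+
qed

lemma quotient_simps:
  "vcarrier (quotient_space s t) = range (\<lambda>x. x +o null_space t)"
  "vadd (quotient_space s t) (x +o null_space t) (y +o null_space t) = (x + y) +o null_space t"
  "vscale (quotient_space s t) c (x +o null_space t) = s c x +o null_space t"
  "ip (quotient_space s t) (x +o null_space t) (y +o null_space t) = t x y"
  using quotient_add[of x y] quotient_scale[of c x] quotient_ip[of x y]
  by (simp_all add: quotient_space_def)

lemma definite_ip_quotient: "definite_ip (quotient_space s t)"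
proof
  show "A = B"
    if AB: "A \<in> vcarrier (quotient_space s t)" "B \<in> vcarrier (quotient_space s t)"
      "vnorm (quotient_space s t) (vdiff (quotient_space s t) A B) = 0" for A B
  proof -
    obtain x y where xy: "A = x +o null_space t" "B = y +o null_space t"
      using AB(1,2) unfolding quotient_simps(1) by blast
    have "Re (t (x - y) (x - y)) = 0"
      using AB(3) by (simp add: xy vnorm_def vdiff_def quotient_simps scale_minus_one)
    then have "x - y \<in> null_space t"
      by (simp add: null_space_def form_self complex_eq_iff)
    then show ?thesis
      by (simp add: xy coset_eq null_space_iff form_diff)
  qed
qed (auto simp: quotient_simps form_add form_scale form_self intro: form_cnj)

lemma definite_ip_form_hilbert: "definite_ip (form_hilbert s t)"
  unfolding form_hilbert_def
  by (intro definite_ip.definite_ip_completion definite_ip_quotient)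

end

section \<open>Cosets as a dense subspace\<close>

sublocale herm_form \<subseteq> H: definite_ip "form_hilbert s t"
  by (rule definite_ip_form_hilbert)

context herm_form
begin

lemma coset_closed [simp]: "coset s t x \<in> vcarrier (form_hilbert s t)"
  unfolding coset_def form_hilbert_def
  by (intro definite_ip.embed_closed definite_ip_quotient) (simp add: quotient_simps)

lemma coset_add: "coset s t (x + y) = vadd (form_hilbert s t) (coset s t x) (coset s t y)"
  unfolding coset_def form_hilbert_def
  by (subst definite_ip.embed_add[OF definite_ip_quotient, symmetric]) (simp_all add: quotient_simps)

lemma coset_scale: "coset s t (s c x) = vscale (form_hilbert s t) c (coset s t x)"
  unfolding coset_def form_hilbert_def
  by (subst definite_ip.embed_scale[OF definite_ip_quotient, symmetric]) (simp_all add: quotient_simps)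

lemma coset_diff: "coset s t (x - y) = vdiff (form_hilbert s t) (coset s t x) (coset s t y)"
proof -
  interpret vector_space s
    by (rule vs)
  show ?thesis
    using coset_add[of x "- y"] coset_scale[of "- 1" y] by (simp add: vdiff_def scale_minus_one)
qed

lemma ip_coset [simp]: "ip (form_hilbert s t) (coset s t x) (coset s t y) = t x y"
  unfolding coset_def form_hilbert_def
  by (subst definite_ip.ip_embed[OF definite_ip_quotient]) (simp_all add: quotient_simps)

lemma coset_dense:
  assumes "h \<in> vcarrier (form_hilbert s t)"
  obtains f where "vlim (form_hilbert s t) (\<lambda>n. coset s t (f n)) h"
proof -
  interpret Q: definite_ip "quotient_space s t"
    by (rule definite_ip_quotient)
  obtain F where F: "F \<in> cauchy_seqs (quotient_space s t)" "h = Q.cauchy_class F"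
    using assms unfolding form_hilbert_def by (rule Q.cauchy_class_cases)
  have "\<forall>n. \<exists>x. F n = x +o null_space t"
    using Q.cauchy_seqs_closed[OF F(1)] by (auto simp: quotient_simps)
  then obtain f where f: "\<And>n. F n = f n +o null_space t"
    by metis
  show ?thesis
    using Q.vlim_embed[OF F(1)] that[of f] by (simp add: F(2) f coset_def form_hilbert_def)
qed

text \<open>The form of completeness on which \<open>riesz\<close> rests: the limit is the class of
  the given sequence of cosets.\<close>

lemma coset_complete:
  assumes cauchy: "\<And>e. e > 0 \<Longrightarrow> \<exists>N. \<forall>m\<ge>N. \<forall>n\<ge>N.
    vnorm (form_hilbert s t) (vdiff (form_hilbert s t) (coset s t (f m)) (coset s t (f n))) < e"
  obtains h where "h \<in> vcarrier (form_hilbert s t)"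
    "vlim (form_hilbert s t) (\<lambda>n. coset s t (f n)) h"
proof -
  interpret Q: definite_ip "quotient_space s t"
    by (rule definite_ip_quotient)
  interpret vector_space s
    by (rule vs)
  let ?F = "\<lambda>n. f n +o null_space t"
  have "vnorm (form_hilbert s t) (vdiff (form_hilbert s t) (coset s t (f m)) (coset s t (f n))) =
      vnorm (quotient_space s t) (vdiff (quotient_space s t) (?F m) (?F n))" for m n
    unfolding coset_diff[symmetric]
    by (simp add: vnorm_def vdiff_def quotient_simps scale_minus_one)
  then have F: "?F \<in> cauchy_seqs (quotient_space s t)"
    using cauchy by (simp add: Q.cauchy_seqs_iff quotient_simps(1))
  show ?thesis
    using Q.cauchy_class_closed[OF F] Q.vlim_embed[OF F] that
    by (simp add: coset_def form_hilbert_def)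
qed

text \<open>By density and continuity of the inner product, cosets separate the points of the
  Hilbert space.\<close>

lemma coset_ip_eqI:
  assumes h: "h \<in> vcarrier (form_hilbert s t)" and k: "k \<in> vcarrier (form_hilbert s t)"
    and eq: "\<And>x. ip (form_hilbert s t) (coset s t x) h = ip (form_hilbert s t) (coset s t x) k"
  shows "h = k"
proof (rule H.ip_eqI[OF h k])
  fix z
  assume z: "z \<in> vcarrier (form_hilbert s t)"
  obtain f where f: "vlim (form_hilbert s t) (\<lambda>n. coset s t (f n)) z"
    using coset_dense[OF z] by blast
  have "ip (form_hilbert s t) z h = ip (form_hilbert s t) z k"
    using H.vlim_ip[OF f _ z H.vlim_const[OF h] h h] H.vlim_ip[OF f _ z H.vlim_const[OF k] k k]
    by (simp add: eq LIMSEQ_unique)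
  then show "ip (form_hilbert s t) h z = ip (form_hilbert s t) k z"
    using H.ip_cnj[OF z h] H.ip_cnj[OF z k] by simp
qed

text \<open>The representing vector is the limit of a minimising sequence of \<open>\<parallel>x\<parallel>\<^sup>2 - 2 Re (\<phi> x)\<close>.\<close>

lemma riesz:
  fixes \<phi> :: "'a \<Rightarrow> complex"
  assumes add: "\<And>x y. \<phi> (x + y) = \<phi> x + \<phi> y" and scale: "\<And>a x. \<phi> (s a x) = a * \<phi> x"
    and bound: "\<And>x. cmod (\<phi> x) \<le> C * vnorm (form_hilbert s t) (coset s t x)"
  obtains k where "k \<in> vcarrier (form_hilbert s t)"
    "\<And>x. ip (form_hilbert s t) (coset s t x) k = \<phi> x"
proof -
  let ?H = "form_hilbert s t" and ?c = "coset s t"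
  let ?q = "\<lambda>x. vnorm ?H (?c x)"
  define g where "g x = (?q x)\<^sup>2 - 2 * Re (\<phi> x)" for x
  have q_sq: "(?q x)\<^sup>2 = Re (t x x)" for x
    by (simp add: H.vnorm_sq)
  \<comment> \<open>The hypothesis on \<phi> gives g x \<ge> q^2 - 2 C q = (q - C)^2 - C^2, where q
    is the norm of the coset of x.\<close>
  have lower: "- (C\<^sup>2) \<le> g x" for x
  proof -
    have "Re (\<phi> x) \<le> C * ?q x"
      using bound[of x] complex_Re_le_cmod[of "\<phi> x"] by simp
    moreover have "0 \<le> (?q x - C)\<^sup>2"
      by simp
    ultimately show ?thesis
      by (simp add: g_def power2_diff mult.commute)
  qed
  define m where "m = Inf (range g)"
  have bdd: "bdd_below (range g)"
    using lower by (intro bdd_belowI2)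
  then have m_le: "m \<le> g x" for x
    unfolding m_def by (intro cInf_lower) auto
  have "\<exists>x. g x < m + inverse (real (Suc n))" for n
    using cInf_lessD[of "range g" "m + inverse (real (Suc n))"] by (auto simp: m_def)
  then obtain f where f: "\<And>n. g (f n) < m + inverse (real (Suc n))"
    by metis
  \<comment> \<open>This is the parallelogram law at the midpoint \<open>?z\<close>. The linear
    parts of g cancel in 2 g x + 2 g y - 4 g ?z, and g ?z is at least m.\<close>
  have parallelogram: "(vnorm ?H (vdiff ?H (?c x) (?c y)))\<^sup>2 \<le> 2 * g x + 2 * g y - 4 * m" for x y
  proof -
    let ?z = "s (1/2) (x + y)"
    have "(vnorm ?H (vdiff ?H (?c x) (?c y)))\<^sup>2 = Re (t (x - y) (x - y))"
      by (simp add: H.vnorm_sq flip: coset_diff)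
    moreover have "4 * g ?z = Re (t (x + y) (x + y)) - 4 * Re (\<phi> x + \<phi> y)"
      unfolding g_def q_sq form_scale form_scale_right scale add by (simp add: field_simps)
    ultimately show ?thesis
      using m_le[of ?z]
      by (simp add: g_def q_sq form_add form_add_right form_diff form_diff_right)
  qed
  have "\<exists>N. \<forall>i\<ge>N. \<forall>j\<ge>N. vnorm ?H (vdiff ?H (?c (f i)) (?c (f j))) < e" if "e > 0" for e
  proof -
    from that have "e\<^sup>2 / 4 > 0"
      by simp
    \<comment> \<open>With this N the parallelogram bound 2 / (i + 1) + 2 / (j + 1) stays below
      e^2.\<close>
    then obtain N where N: "inverse (real (Suc N)) < e\<^sup>2 / 4"
      using reals_Archimedean by blast
    have "vnorm ?H (vdiff ?H (?c (f i)) (?c (f j))) < e" if "i \<ge> N" "j \<ge> N" for i j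
    proof (rule power2_less_imp_less)
      have "inverse (real (Suc i)) \<le> inverse (real (Suc N))" "inverse (real (Suc j)) \<le> inverse (real (Suc N))"
        using that by (auto intro!: le_imp_inverse_le)
      then show "(vnorm ?H (vdiff ?H (?c (f i)) (?c (f j))))\<^sup>2 < e\<^sup>2"
        using parallelogram[of "f i" "f j"] f[of i] f[of j] N by linarith
    qed (use \<open>e > 0\<close> in simp)
    then show ?thesis
      by blast
  qed
  then obtain k where k: "k \<in> vcarrier ?H" and lim: "vlim ?H (\<lambda>n. ?c (f n)) k"
    by (rule coset_complete)
  have "ip ?H (?c x) k = \<phi> x" for x
  proof -
    define d where "d = ip ?H (?c x) k - \<phi> x"
    \<comment> \<open>Moving from \<open>f n\<close> by a x cannot bring g below m, while
      \<open>g (f n)\<close> exceeds m by less than 1 / (n + 1). Expanding the square and letting n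
      tend to infinity gives the inequality.\<close>
    have variation: "0 \<le> 2 * Re (a * d) + (cmod a)\<^sup>2 * (?q x)\<^sup>2" for a
    proof (rule LIMSEQ_le_const)
      let ?e = "\<lambda>n. inverse (real (Suc n)) + 2 * Re (a * (t x (f n) - \<phi> x)) + (cmod a)\<^sup>2 * (?q x)\<^sup>2"
      have "(\<lambda>n. t x (f n)) \<longlonglongrightarrow> ip ?H (?c x) k"
        using H.vlim_ip[OF H.vlim_const _ _ lim _ k, of "?c x"] by simp
      then have "?e \<longlonglongrightarrow> 0 + 2 * Re (a * d) + (cmod a)\<^sup>2 * (?q x)\<^sup>2"
        unfolding d_def by (intro tendsto_intros LIMSEQ_inverse_real_of_nat)
      then show "?e \<longlonglongrightarrow> 2 * Re (a * d) + (cmod a)\<^sup>2 * (?q x)\<^sup>2"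
        by simp
      have "0 \<le> ?e n" for n
      proof -
        have "(?q (f n + s a x))\<^sup>2 = (?q (f n))\<^sup>2 + 2 * Re (a * t x (f n)) + (cmod a)\<^sup>2 * (?q x)\<^sup>2"
          using H.vnorm_sq_add_scale[of "?c (f n)" "?c x" a] by (simp add: coset_add coset_scale)
        then show ?thesis
          using m_le[of "f n + s a x"] f[of n] by (simp add: g_def add scale algebra_simps)
      qed
      then show "\<exists>N. \<forall>n\<ge>N. 0 \<le> ?e n"
        by blast
    qed
    have "d = 0"
    proof (rule ccontr)
      assume "d \<noteq> 0"
      define p where "p = (?q x)\<^sup>2"
      \<comment> \<open>The step a = -u cnj d turns the variation into u |d|^2 (u p - 2). The choice
        of u makes u p < 1, also when p = 0, so this is negative.\<close>
      define u where "u = 1 / (p + 1)"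
      have p: "p \<ge> 0"
        by (simp add: p_def)
      then have u: "u > 0" "u * p < 1"
        by (simp_all add: u_def)
      let ?a = "complex_of_real (- u) * cnj d"
      have "?a * d = complex_of_real (- u * (cmod d)\<^sup>2)"
        using complex_norm_square[of d] by (simp add: mult.assoc mult.commute[of "cnj d"])
      then have "Re (?a * d) = - u * (cmod d)\<^sup>2"
        by (metis Re_complex_of_real)
      moreover have "(cmod ?a)\<^sup>2 = u\<^sup>2 * (cmod d)\<^sup>2"
        by (simp add: norm_mult power_mult_distrib)
      ultimately have "0 \<le> 2 * (- u * (cmod d)\<^sup>2) + u\<^sup>2 * (cmod d)\<^sup>2 * p"
        using variation[of ?a] by (simp only: p_def)
      also have "\<dots> = u * (cmod d)\<^sup>2 * (u * p - 2)"
        by (simp add: algebra_simps power2_eq_square)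
      also have "\<dots> < 0"
        using u \<open>d \<noteq> 0\<close> by (intro mult_pos_neg) auto
      finally show False
        by simp
    qed
    then show ?thesis
      by (simp add: d_def)
  qed
  then show ?thesis
    using k that by blast
qed

text \<open>\<open>F\<close> lives only on the dense space of cosets, yet its adjoint is defined on
  all of \<open>Y\<close>: for each y the functional x \<mapsto> (F x | y) is bounded and Riesz
  representation applies. Completeness is thus used on the side of the values of \<open>G\<close>
  alone.\<close>

lemma adjoint_of_dense_operator:
  assumes "semi_ip Y"
    and F: "\<And>x. F x \<in> vcarrier Y"
    and add: "\<And>x y. F (x + y) = vadd Y (F x) (F y)" and scale: "\<And>a x. F (s a x) = vscale Y a (F x)"
    and bound: "\<And>x. vnorm Y (F x) \<le> C * vnorm (form_hilbert s t) (coset s t x)"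
  obtains G where "G \<in> bounded_ops Y (form_hilbert s t)"
    "\<And>x y. y \<in> vcarrier Y \<Longrightarrow> ip (form_hilbert s t) (coset s t x) (G y) = ip Y (F x) y"
proof -
  interpret Y: semi_ip Y by fact
  let ?H = "form_hilbert s t" and ?c = "coset s t"
  have bound': "cmod (ip Y (F x) y) \<le> C * vnorm Y y * vnorm ?H (?c x)" if "y \<in> vcarrier Y" for x y
  proof -
    have "cmod (ip Y (F x) y) \<le> vnorm Y (F x) * vnorm Y y"
      using that F by (intro Y.cauchy_schwarz)
    also have "\<dots> \<le> C * vnorm ?H (?c x) * vnorm Y y"
      using that bound by (intro mult_right_mono) auto
    finally show ?thesis
      by (simp add: mult_ac)
  qed
  have "\<exists>k\<in>vcarrier ?H. \<forall>x. ip ?H (?c x) k = ip Y (F x) y" if y: "y \<in> vcarrier Y" for y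
  proof -
    obtain k where "k \<in> vcarrier ?H" "\<And>x. ip ?H (?c x) k = ip Y (F x) y"
      by (rule riesz[of "\<lambda>x. ip Y (F x) y", OF _ _ bound'[OF y]])
        (use y F in \<open>auto simp: add scale\<close>)
    then show ?thesis
      by blast
  qed
  then obtain G0 where G0: "\<And>y. y \<in> vcarrier Y \<Longrightarrow> G0 y \<in> vcarrier ?H"
      "\<And>x y. y \<in> vcarrier Y \<Longrightarrow> ip ?H (?c x) (G0 y) = ip Y (F x) y"
    by metis
  define G where "G = restrict G0 (vcarrier Y)"
  have G: "\<And>y. y \<in> vcarrier Y \<Longrightarrow> G y \<in> vcarrier ?H"
      "\<And>x y. y \<in> vcarrier Y \<Longrightarrow> ip ?H (?c x) (G y) = ip Y (F x) y"
    using G0 by (simp_all add: G_def)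
  have "G \<in> bounded_ops Y ?H"
  proof (rule bounded_opsI[where C = "\<bar>C\<bar>"])
    fix y assume y: "y \<in> vcarrier Y"
    show "vnorm ?H (G y) \<le> \<bar>C\<bar> * vnorm Y y"
    \<comment> \<open>For a nonzero norm, test the defining identity with cosets tending to
      \<open>G y\<close> itself and cancel one factor. In the zero case the absolute value of C
      makes the bound nonnegative.\<close>
    proof (cases "vnorm ?H (G y) = 0")
      case False
      obtain f where f: "vlim ?H (\<lambda>n. ?c (f n)) (G y)"
        using coset_dense[OF G(1)[OF y]] by blast
      have "(\<lambda>n. cmod (ip ?H (?c (f n)) (G y))) \<longlonglongrightarrow> cmod (ip ?H (G y) (G y))"
        using f G(1)[OF y] by (intro tendsto_norm H.vlim_ip H.vlim_const) auto
      moreover have "(\<lambda>n. C * vnorm Y y * vnorm ?H (?c (f n))) \<longlonglongrightarrow> C * vnorm Y y * vnorm ?H (G y)"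
        using f G(1)[OF y] by (intro tendsto_intros H.vlim_vnorm) auto
      ultimately have "cmod (ip ?H (G y) (G y)) \<le> C * vnorm Y y * vnorm ?H (G y)"
        using bound'[OF y] by (intro LIMSEQ_le) (auto simp: G(2)[OF y])
      moreover have "cmod (ip ?H (G y) (G y)) = (vnorm ?H (G y))\<^sup>2"
        unfolding H.ip_self[OF G(1)[OF y]] by (simp only: norm_of_real) simp
      ultimately have "vnorm ?H (G y) * vnorm ?H (G y) \<le> C * vnorm Y y * vnorm ?H (G y)"
        by (simp add: power2_eq_square)
      then have "vnorm ?H (G y) \<le> C * vnorm Y y"
        using False H.vnorm_nonneg[OF G(1)[OF y]] by (simp add: mult_le_cancel_right)
      also have "\<dots> \<le> \<bar>C\<bar> * vnorm Y y"
        using y by (intro mult_right_mono) auto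
      finally show ?thesis .
    qed (use y in simp)
    show "G (vscale Y a y) = vscale ?H a (G y)" for a
      using y F G by (intro coset_ip_eqI) auto
    show "G (vadd Y y z) = vadd ?H (G y) (G z)" if "z \<in> vcarrier Y" for z
      using y that F G by (intro coset_ip_eqI) auto
  qed (use G in \<open>auto simp: G_def\<close>)
  then show ?thesis
    using G(2) that by blast
qed

lemma bounded_ops_coset_eqI:
  assumes "A \<in> bounded_ops (form_hilbert s t) Y" "B \<in> bounded_ops (form_hilbert s t) Y" "definite_ip Y"
    and "\<And>x. A (coset s t x) = B (coset s t x)"
  shows "A = B"
proof (rule bounded_ops_eqI_dense[OF assms(1,2) H.semi_ip_axioms assms(3), of "range (coset s t)"])
  show "\<exists>f. (\<forall>n. f n \<in> range (coset s t)) \<and> vlim (form_hilbert s t) f x"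
    if "x \<in> vcarrier (form_hilbert s t)" for x
    using coset_dense[OF that] by (metis rangeI)
qed (use assms(4) in auto)

lemma repr_op_eqI:
  assumes A: "A \<in> bounded_ops (form_hilbert s t) (form_hilbert s t)"
    and eq: "\<And>x y. ip (form_hilbert s t) (A (coset s t x)) (coset s t y) = q x y"
  shows "repr_op s t q = A"
  unfolding repr_op_def
proof (rule the_equality)
  let ?H = "form_hilbert s t"
  fix B
  assume B: "B \<in> bounded_ops ?H ?H \<and> (\<forall>x y. ip ?H (B (coset s t x)) (coset s t y) = q x y)"
  show "B = A"
  proof (rule bounded_ops_coset_eqI[OF conjunct1[OF B] A H.definite_ip_axioms], rule coset_ip_eqI)
    fix x y
    have cl: "A (coset s t x) \<in> vcarrier ?H" "B (coset s t x) \<in> vcarrier ?H"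
      using A B by (auto intro: bounded_opsD(1))
    then show "B (coset s t x) \<in> vcarrier ?H" "A (coset s t x) \<in> vcarrier ?H"
      by simp_all
    show "ip ?H (coset s t y) (B (coset s t x)) = ip ?H (coset s t y) (A (coset s t x))"
      using H.ip_cnj[OF cl(1) coset_closed[of y]] H.ip_cnj[OF cl(2) coset_closed[of y]] B eq by simp
  qed
qed (use A eq in auto)

end

section \<open>The parallel sum\<close>

lemma form_sum_apply: "form_sum t w x y = t x y + w x y"
  by (simp add: form_sum_def)

text \<open>Domination makes the identity of the underlying space contractive, but only between
  cosets. Taking the adjoint gives the everywhere defined \<open>S\<close>; taking the adjoint of
  \<open>S\<close> along cosets gives an everywhere defined \<open>i\<close> that extends the
  original map.\<close>

lemma dominated_form_transport:
  assumes "herm_form s t" "herm_form s r" and le: "\<And>x. Re (t x x) \<le> Re (r x x)"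
  obtains S i where "S \<in> bounded_ops (form_hilbert s t) (form_hilbert s r)"
    "i \<in> bounded_ops (form_hilbert s r) (form_hilbert s t)"
    "\<And>x. i (coset s r x) = coset s t x"
    "\<And>a h. a \<in> vcarrier (form_hilbert s t) \<Longrightarrow> h \<in> vcarrier (form_hilbert s r) \<Longrightarrow>
      ip (form_hilbert s r) (S a) h = ip (form_hilbert s t) a (i h)"
proof -
  interpret T: herm_form s t by fact
  interpret R: herm_form s r by fact
  let ?T = "form_hilbert s t" and ?R = "form_hilbert s r"
  let ?c = "coset s t" and ?d = "coset s r"
  have contraction: "vnorm ?T (?c x) \<le> 1 * vnorm ?R (?d x)" for x
    using le by (simp add: vnorm_def)
  obtain S where S: "S \<in> bounded_ops ?T ?R"
      and S_adj: "\<And>x a. a \<in> vcarrier ?T \<Longrightarrow> ip ?R (?d x) (S a) = ip ?T (?c x) a"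
    using R.adjoint_of_dense_operator[OF T.H.semi_ip_axioms T.coset_closed T.coset_add T.coset_scale contraction]
    by blast
  note [simp] = bounded_opsD(1)[OF S]
  obtain C where C: "\<And>a. a \<in> vcarrier ?T \<Longrightarrow> vnorm ?R (S a) \<le> C * vnorm ?T a"
    using bounded_ops_bound[OF S] by blast
  obtain i where i: "i \<in> bounded_ops ?R ?T"
      and i_adj: "\<And>x h. h \<in> vcarrier ?R \<Longrightarrow> ip ?T (?c x) (i h) = ip ?R (S (?c x)) h"
  proof (rule T.adjoint_of_dense_operator[OF R.H.semi_ip_axioms, of "\<lambda>x. S (?c x)"])
    show "vnorm ?R (S (?c x)) \<le> C * vnorm ?T (?c x)" for x
      by (rule C) simp
  qed (auto simp: T.coset_add T.coset_scale bounded_opsD[OF S])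
  note [simp] = bounded_opsD(1)[OF i]
  \<comment> \<open>Against the coset of x both sides give t x y, since the inner product of
    \<open>S (?c x)\<close> with \<open>?d y\<close> is the conjugate of t y x.\<close>
  have i_coset: "i (?d y) = ?c y" for y
  proof (rule T.coset_ip_eqI)
    fix x
    have "ip ?R (S (?c x)) (?d y) = cnj (ip ?R (?d y) (S (?c x)))"
      by (rule R.H.ip_cnj) simp_all
    then show "ip ?T (?c x) (i (?d y)) = ip ?T (?c x) (?c y)"
      by (simp add: S_adj i_adj flip: T.form_cnj)
  qed simp_all
  \<comment> \<open>The adjoint relation is known for cosets in the first argument and extends to
    \<open>a\<close> by continuity of \<open>S\<close>.\<close>
  have "ip ?R (S a) h = ip ?T a (i h)" if a: "a \<in> vcarrier ?T" and h: "h \<in> vcarrier ?R" for a h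
  proof -
    obtain f where f: "vlim ?T (\<lambda>n. ?c (f n)) a"
      using T.coset_dense[OF a] by blast
    have "vlim ?R (\<lambda>n. S (?c (f n))) (S a)"
      by (rule bounded_ops_vlim[OF S T.H.semi_ip_axioms R.H.semi_ip_axioms _ a f]) simp
    then have "(\<lambda>n. ip ?R (S (?c (f n))) h) \<longlonglongrightarrow> ip ?R (S a) h"
      using a h by (intro R.H.vlim_ip R.H.vlim_const) simp_all
    moreover have "(\<lambda>n. ip ?R (S (?c (f n))) h) \<longlonglongrightarrow> ip ?T a (i h)"
      unfolding i_adj[OF h, symmetric] using a h f by (intro T.H.vlim_ip T.H.vlim_const) simp_all
    ultimately show ?thesis
      by (rule LIMSEQ_unique)
  qed
  then show ?thesis
    using that S i i_coset by blast
qed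

text \<open>Here \<open>iT\<close>, \<open>iW\<close> are the canonical contractions \<open>H\<^sub>\<t>\<^sub>+\<^sub>\<w> \<rightarrow> H\<^sub>\<t>\<close>, \<open>H\<^sub>\<t>\<^sub>+\<^sub>\<w> \<rightarrow> H\<^sub>\<w>\<close> and \<open>ST\<close>, \<open>SW\<close>
  their adjoints, so that \<open>T = ST iT\<close> and \<open>W = SW iW\<close>.\<close>

locale form_pair = T: herm_form s t + W: herm_form s w + R: herm_form s "form_sum t w"
  for s :: "complex \<Rightarrow> 'a::ab_group_add \<Rightarrow> 'a" and t w +
  fixes ST SW iT iW
  assumes ST: "ST \<in> bounded_ops (form_hilbert s t) (form_hilbert s (form_sum t w))"
    and SW: "SW \<in> bounded_ops (form_hilbert s w) (form_hilbert s (form_sum t w))"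
    and iT: "iT \<in> bounded_ops (form_hilbert s (form_sum t w)) (form_hilbert s t)"
    and iW: "iW \<in> bounded_ops (form_hilbert s (form_sum t w)) (form_hilbert s w)"
    and iT_coset [simp]: "iT (coset s (form_sum t w) x) = coset s t x"
    and iW_coset [simp]: "iW (coset s (form_sum t w) x) = coset s w x"
    and ip_ST [simp]: "a \<in> vcarrier (form_hilbert s t) \<Longrightarrow> h \<in> vcarrier (form_hilbert s (form_sum t w)) \<Longrightarrow>
      ip (form_hilbert s (form_sum t w)) (ST a) h = ip (form_hilbert s t) a (iT h)"
    and ip_SW [simp]: "b \<in> vcarrier (form_hilbert s w) \<Longrightarrow> h \<in> vcarrier (form_hilbert s (form_sum t w)) \<Longrightarrow>
      ip (form_hilbert s (form_sum t w)) (SW b) h = ip (form_hilbert s w) b (iW h)"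
begin

abbreviation "HT \<equiv> form_hilbert s t"
abbreviation "HW \<equiv> form_hilbert s w"
abbreviation "HR \<equiv> form_hilbert s (form_sum t w)"
abbreviation "K \<equiv> ip_prod HT HW"
abbreviation "cT \<equiv> coset s t"
abbreviation "cW \<equiv> coset s w"
abbreviation "cR \<equiv> coset s (form_sum t w)"

lemma K_eq: "form_prod s t w = K"
  by (simp add: form_prod_def)

lemma definite_K: "definite_ip K"
  by (intro definite_ip_prod T.definite_ip_form_hilbert W.definite_ip_form_hilbert)

sublocale K: definite_ip K
  by (rule definite_K)

lemma ops_closed [simp]:
  "a \<in> vcarrier HT \<Longrightarrow> ST a \<in> vcarrier HR"
  "b \<in> vcarrier HW \<Longrightarrow> SW b \<in> vcarrier HR"
  "h \<in> vcarrier HR \<Longrightarrow> iT h \<in> vcarrier HT"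
  "h \<in> vcarrier HR \<Longrightarrow> iW h \<in> vcarrier HW"
  by (intro bounded_opsD(1)[OF ST] bounded_opsD(1)[OF SW] bounded_opsD(1)[OF iT] bounded_opsD(1)[OF iW]; assumption)+

lemma ip_ST_right [simp]:
  "a \<in> vcarrier HT \<Longrightarrow> h \<in> vcarrier HR \<Longrightarrow> ip HR h (ST a) = ip HT (iT h) a"
  using R.H.ip_cnj[of "ST a" h] T.H.ip_cnj[of a "iT h"] by simp

lemma ip_SW_right [simp]:
  "b \<in> vcarrier HW \<Longrightarrow> h \<in> vcarrier HR \<Longrightarrow> ip HR h (SW b) = ip HW (iW h) b"
  using R.H.ip_cnj[of "SW b" h] W.H.ip_cnj[of b "iW h"] by simp

lemma ST_SW_coset: "vadd HR (ST (cT x)) (SW (cW x)) = cR x"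
  by (rule R.coset_ip_eqI) (simp_all add: form_sum_apply)

text \<open>Paired with a coset, the operators move onto that coset by symmetry, and there
  \<open>ST_SW_coset\<close> applies, where t + w is by definition the form of the large
  space.\<close>

lemma T_plus_W:
  assumes h: "h \<in> vcarrier HR"
  shows "vadd HR (ST (iT h)) (SW (iW h)) = h"
proof (rule R.coset_ip_eqI)
  fix x
  have "ip HR (cR x) h = ip HR (vadd HR (ST (cT x)) (SW (cW x))) h"
    by (simp add: ST_SW_coset)
  then show "ip HR (cR x) (vadd HR (ST (iT h)) (SW (iW h))) = ip HR (cR x) h"
    using h by simp
qed (use h in simp_all)

lemma ip_T_plus_W:
  assumes "h \<in> vcarrier HR" "z \<in> vcarrier HR"
  shows "ip HT (iT h) (iT z) + ip HW (iW h) (iW z) = ip HR h z"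
  using assms arg_cong[OF T_plus_W[OF assms(1)], of "\<lambda>u. ip HR u z"] by simp

section \<open>Explicit formulas for the operators of the statement\<close>

lemma repr_op_T: "repr_op s (form_sum t w) t (cR x) = ST (cT x)"
proof -
  have "repr_op s (form_sum t w) t = (\<lambda>h\<in>vcarrier HR. ST (iT h))"
    by (rule R.repr_op_eqI[OF bounded_ops_compose[OF iT ST R.H.semi_ip_axioms T.H.semi_ip_axioms]]) simp
  then show ?thesis
    by simp
qed

lemma repr_op_W: "repr_op s (form_sum t w) w (cR x) = SW (cW x)"
proof -
  have "repr_op s (form_sum t w) w = (\<lambda>h\<in>vcarrier HR. SW (iW h))"
    by (rule R.repr_op_eqI[OF bounded_ops_compose[OF iW SW R.H.semi_ip_axioms W.H.semi_ip_axioms]]) simp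
  then show ?thesis
    by simp
qed

lemma extend_op_eqI:
  assumes A: "A \<in> bounded_ops K HR" and eq: "\<And>x y. A (cT x, cW y) = F x y"
  shows "extend_op s t w F = A"
  unfolding extend_op_def K_eq
proof (rule the_equality)
  fix B
  assume B: "B \<in> bounded_ops K HR \<and> (\<forall>x y. B (cT x, cW y) = F x y)"
  show "B = A"
  proof (rule bounded_ops_eqI_dense[OF conjunct1[OF B] A K.semi_ip_axioms R.H.definite_ip_axioms,
        of "range (\<lambda>(x, y). (cT x, cW y))"])
    fix k
    assume "k \<in> vcarrier K"
    then obtain a b where k: "k = (a, b)" "a \<in> vcarrier HT" "b \<in> vcarrier HW"
      by (auto simp: ip_prod_simps)
    obtain f where f: "vlim HT (\<lambda>n. cT (f n)) a"
      using T.coset_dense[OF k(2)] by blast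
    obtain g where g: "vlim HW (\<lambda>n. cW (g n)) b"
      using W.coset_dense[OF k(3)] by blast
    have "vlim K (\<lambda>n. (cT (f n), cW (g n))) k"
      unfolding k(1) using k f g
      by (intro vlim_prod T.H.definite_ip_axioms W.H.definite_ip_axioms) simp_all
    then show "\<exists>F. (\<forall>n. F n \<in> range (\<lambda>(x, y). (cT x, cW y))) \<and> vlim K F k"
      by (intro exI[of _ "\<lambda>n. (cT (f n), cW (g n))"]) auto
  qed (use B eq in \<open>auto simp: ip_prod_simps\<close>)
qed (use A eq in auto)

definition "JT = (\<lambda>k\<in>vcarrier K. ST (fst k))"
definition "JW = (\<lambda>k\<in>vcarrier K. SW (snd k))"
definition "J = (\<lambda>k\<in>vcarrier K. vadd HR (JT k) (JW k))"
definition "J_adj = (\<lambda>h\<in>vcarrier HR. (iT h, iW h))"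

text \<open>The zero vectors of \<open>H\<^sub>\<w>\<close> and \<open>H\<^sub>\<t>\<close> are written as multiples by the scalar 0.\<close>

definition "JT_adj = (\<lambda>h\<in>vcarrier HR. (iT h, vscale HW 0 (iW h)))"
definition "JW_adj = (\<lambda>h\<in>vcarrier HR. (vscale HT 0 (iT h), iW h))"

lemma JT_bounded: "JT \<in> bounded_ops K HR"
  using bounded_ops_compose[OF bounded_ops_fst[OF T.H.semi_ip_axioms W.H.semi_ip_axioms] ST
      K.semi_ip_axioms T.H.semi_ip_axioms]
  by (simp add: JT_def cong: restrict_cong)

lemma JW_bounded: "JW \<in> bounded_ops K HR"
  using bounded_ops_compose[OF bounded_ops_snd[OF T.H.semi_ip_axioms W.H.semi_ip_axioms] SW
      K.semi_ip_axioms W.H.semi_ip_axioms]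
  by (simp add: JW_def cong: restrict_cong)

lemma J_bounded: "J \<in> bounded_ops K HR"
  unfolding J_def
  by (intro bounded_ops_add JT_bounded JW_bounded K.semi_ip_axioms R.H.definite_ip_axioms)

lemma J_adj_bounded: "J_adj \<in> bounded_ops HR K"
  unfolding J_adj_def
  by (intro bounded_ops_pair iT iW R.H.semi_ip_axioms T.H.semi_ip_axioms W.H.semi_ip_axioms)

lemma JT_adj_bounded: "JT_adj \<in> bounded_ops HR K"
  using bounded_ops_pair[OF iT bounded_ops_scale[OF iW R.H.semi_ip_axioms W.H.definite_ip_axioms, of 0]
      R.H.semi_ip_axioms T.H.semi_ip_axioms W.H.semi_ip_axioms]
  by (simp add: JT_adj_def cong: restrict_cong)

lemma JW_adj_bounded: "JW_adj \<in> bounded_ops HR K"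
  using bounded_ops_pair[OF bounded_ops_scale[OF iT R.H.semi_ip_axioms T.H.definite_ip_axioms, of 0] iW
      R.H.semi_ip_axioms T.H.semi_ip_axioms W.H.semi_ip_axioms]
  by (simp add: JW_adj_def cong: restrict_cong)

lemma JT_op_eq: "JT_op s t w = JT"
  unfolding JT_op_def Let_def
  by (rule extend_op_eqI[OF JT_bounded]) (simp add: JT_def ip_prod_simps repr_op_T)

lemma JW_op_eq: "JW_op s t w = JW"
  unfolding JW_op_def Let_def
  by (rule extend_op_eqI[OF JW_bounded]) (simp add: JW_def ip_prod_simps repr_op_W)

lemma J_op_eq: "J_op s t w = J"
  unfolding J_op_def Let_def
  by (rule extend_op_eqI[OF J_bounded])
    (simp add: J_def JT_def JW_def ip_prod_simps repr_op_T repr_op_W)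

lemma adjoint_JT: "adjoint_op K HR JT = JT_adj"
  by (rule adjoint_op_eqI[OF definite_K JT_adj_bounded]) (auto simp: JT_def JT_adj_def ip_prod_simps)

lemma adjoint_JW: "adjoint_op K HR JW = JW_adj"
  by (rule adjoint_op_eqI[OF definite_K JW_adj_bounded]) (auto simp: JW_def JW_adj_def ip_prod_simps)

lemma ip_J:
  "k \<in> vcarrier K \<Longrightarrow> h \<in> vcarrier HR \<Longrightarrow> ip HR (J k) h = ip K k (J_adj h)"
  by (auto simp: J_def JT_def JW_def J_adj_def ip_prod_simps)

lemma adjoint_J: "adjoint_op K HR J = J_adj"
  by (rule adjoint_op_eqI[OF definite_K J_adj_bounded]) (rule ip_J)

lemma J_J_adj: "h \<in> vcarrier HR \<Longrightarrow> J (J_adj h) = h"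
  by (simp add: J_def JT_def JW_def J_adj_def ip_prod_simps T_plus_W)

text \<open>\<open>J\<^sup>*\<close> is isometric, so \<open>J\<^sup>* J\<close> is the orthogonal projection onto its range.\<close>

lemma P_op_apply:
  assumes k: "k \<in> vcarrier K"
  shows "P_op s t w k = vdiff K k (J_adj (J k))"
proof -
  note [simp] = bounded_opsD(1)[OF J_bounded] bounded_opsD(1)[OF J_adj_bounded]
  let ?M = "ortho_compl K (J_adj ` vcarrier HR)" and ?p = "vdiff K k (J_adj (J k))"
  \<comment> \<open>Orthogonality to the range: applying \<open>J\<close> to
    \<open>J_adj (J k)\<close> returns \<open>J k\<close>, so the two terms cancel.\<close>
  have "ip K ?p (J_adj h) = 0" if h: "h \<in> vcarrier HR" for h
  proof -
    have "ip K ?p (J_adj h) = ip K k (J_adj h) - ip K (J_adj (J k)) (J_adj h)"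
      using h k by (intro K.ip_diff) simp_all
    also have "\<dots> = ip HR (J k) h - ip HR (J (J_adj (J k))) h"
      using h k by (subst (1 2) ip_J) simp_all
    finally show ?thesis
      using h k by (simp add: J_J_adj)
  qed
  then have p: "?p \<in> ?M"
    using k by (auto simp: ortho_compl_def)
  \<comment> \<open>The nested difference amounts to \<open>J_adj (J k)\<close>, a vector in the
    range, to which every q in \<open>?M\<close> is orthogonal.\<close>
  have "ip K (vdiff K k ?p) q = 0" if q: "q \<in> ?M" for q
  proof -
    have qK: "q \<in> vcarrier K" and "ip K q (J_adj (J k)) = 0"
      using q k by (auto simp: ortho_compl_def)
    then show ?thesis
      using k K.ip_cnj[OF qK, of "J_adj (J k)"] by simp
  qed
  then have "vdiff K k ?p \<in> ortho_compl K ?M"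
    using k by (simp add: ortho_compl_def)
  then have "ortho_proj K ?M k = ?p"
    using k p by (intro ortho_proj_eqI definite_K) (auto simp: ortho_compl_def)
  then show ?thesis
    by (simp add: P_op_def Let_def K_eq J_op_eq adjoint_J)
qed

text \<open>On the pair with components \<open>iT h\<close> and zero, J gives T h. So P subtracts
  \<open>J_adj\<close> of T h, and \<open>JT\<close> reads only the first component,
  \<open>iT h\<close> minus \<open>iT\<close> of T h, which \<open>ST\<close> maps to T h - T^2
  h.\<close>

lemma compress_JT:
  "compress_P s t w (JT_op s t w) =
    (\<lambda>h\<in>vcarrier HR. vdiff HR (ST (iT h)) (ST (iT (ST (iT h)))))"
proof -
  have "JT (P_op s t w (JT_adj h)) = vdiff HR (ST (iT h)) (ST (iT (ST (iT h))))"
    if h: "h \<in> vcarrier HR" for h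
  proof -
    let ?k = "JT_adj h"
    have k: "?k = (iT h, vscale HW 0 (iW h))" "?k \<in> vcarrier K"
      using h by (simp_all add: JT_adj_def ip_prod_simps)
    have "J ?k = ST (iT h)"
      using h by (intro R.H.ip_eqI) (simp_all add: J_def JT_def JW_def k ip_prod_simps)
    then have "P_op s t w ?k =
        (vdiff HT (iT h) (iT (ST (iT h))), vdiff HW (vscale HW 0 (iW h)) (iW (ST (iT h))))"
      using h by (simp add: P_op_apply[OF k(2)]) (simp add: k J_adj_def vdiff_ip_prod)
    then show ?thesis
      using h by (simp add: JT_def ip_prod_simps bounded_ops_diff[OF ST T.H.semi_ip_axioms])
  qed
  then show ?thesis
    by (simp add: compress_P_def Let_def K_eq JT_op_eq adjoint_JT compose_def cong: restrict_cong)
qed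

lemma compress_JW:
  "compress_P s t w (JW_op s t w) =
    (\<lambda>h\<in>vcarrier HR. vdiff HR (SW (iW h)) (SW (iW (SW (iW h)))))"
proof -
  have "JW (P_op s t w (JW_adj h)) = vdiff HR (SW (iW h)) (SW (iW (SW (iW h))))"
    if h: "h \<in> vcarrier HR" for h
  proof -
    let ?k = "JW_adj h"
    have k: "?k = (vscale HT 0 (iT h), iW h)" "?k \<in> vcarrier K"
      using h by (simp_all add: JW_adj_def ip_prod_simps)
    have "J ?k = SW (iW h)"
      using h by (intro R.H.ip_eqI) (simp_all add: J_def JT_def JW_def k ip_prod_simps)
    then have "P_op s t w ?k =
        (vdiff HT (vscale HT 0 (iT h)) (iT (SW (iW h))), vdiff HW (iW h) (iW (SW (iW h))))"
      using h by (simp add: P_op_apply[OF k(2)]) (simp add: k J_adj_def vdiff_ip_prod)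
    then show ?thesis
      using h by (simp add: JW_def ip_prod_simps bounded_ops_diff[OF SW W.H.semi_ip_axioms])
  qed
  then show ?thesis
    by (simp add: compress_P_def Let_def K_eq JW_op_eq adjoint_JW compose_def cong: restrict_cong)
qed

text \<open>\<open>T - T\<^sup>2 = W - W\<^sup>2\<close> because \<open>T + W = I\<close>.\<close>

lemma compress_JT_eq_JW: "compress_P s t w (JT_op s t w) = compress_P s t w (JW_op s t w)"
proof -
  have "vdiff HR (ST (iT h)) (ST (iT (ST (iT h)))) = vdiff HR (SW (iW h)) (SW (iW (SW (iW h))))"
    if h: "h \<in> vcarrier HR" for h
  proof (rule R.H.ip_eqI)
    fix z
    assume z: "z \<in> vcarrier HR"
    let ?u = "ST (iT h)" and ?v = "SW (iW h)" and ?Tz = "ST (iT z)" and ?Wz = "SW (iW z)"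
    \<comment> \<open>Computing (T h | z) with T + W = I inserted on either side shows (T h | W z) =
      (W h | T z), that is, T and W commute.\<close>
    have "ip HT (iT h) (iT (vadd HR ?Tz ?Wz)) = ip HT (iT h) (iT z)"
      using z by (simp only: T_plus_W)
    then have "ip HT (iT h) (iT ?Tz) + ip HT (iT h) (iT ?Wz) = ip HT (iT h) (iT z)"
      using h z by (simp add: bounded_opsD(2)[OF iT])
    moreover have "ip HT (iT h) (iT ?Tz) + ip HW (iW h) (iW ?Tz) = ip HT (iT h) (iT z)"
      using h z by (simp add: ip_T_plus_W)
    ultimately have commute: "ip HT (iT h) (iT ?Wz) = ip HW (iW h) (iW ?Tz)"
      by (metis add_left_cancel)
    \<comment> \<open>The chain that starts here reads T - T^2 = W T = T W = W - W^2, paired with h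
      and z.\<close>
    have "ip HT (iT ?u) (iT z) + ip HW (iW ?u) (iW z) = ip HT (iT h) (iT z)"
      using h z by (simp add: ip_T_plus_W)
    then have "ip HT (iT h) (iT z) - ip HT (iT ?u) (iT z) = ip HW (iW ?u) (iW z)"
      by (metis add_diff_cancel_left')
    also have "\<dots> = ip HT (iT h) (iT ?Wz)"
      \<comment> \<open>Both sides evaluate (T h | W z) in the large space, with either W or T
        transferred to the other argument. The two evaluations are chained by hand because each
        simplification rule fixes one direction.\<close>
      using trans[OF ip_SW_right[symmetric, of "iW z" ?u] ip_ST[of "iT h" ?Wz]] h z by simp
    also have "\<dots> = ip HT (iT ?v) (iT z)"
      using trans[OF ip_ST_right[symmetric, of "iT z" ?v] ip_SW[of "iW h" ?Tz]] h z commute by simp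
    also have "\<dots> = ip HW (iW h) (iW z) - ip HW (iW ?v) (iW z)"
    proof -
      have "ip HT (iT ?v) (iT z) + ip HW (iW ?v) (iW z) = ip HW (iW h) (iW z)"
        using h z by (simp add: ip_T_plus_W)
      then show ?thesis
        by (metis add_diff_cancel_right')
    qed
    finally have "ip HT (iT h) (iT z) - ip HT (iT ?u) (iT z) = ip HW (iW h) (iW z) - ip HW (iW ?v) (iW z)" .
    then show "ip HR (vdiff HR (ST (iT h)) (ST (iT (ST (iT h))))) z =
        ip HR (vdiff HR (SW (iW h)) (SW (iW (SW (iW h))))) z"
      using h z by simp
  qed (use h in simp_all)
  then show ?thesis
    by (simp add: compress_JT compress_JW cong: restrict_cong)
qed

lemma compress_JT_bounded: "compress_P s t w (JT_op s t w) \<in> bounded_ops HR HR"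
proof -
  note R = R.H.semi_ip_axioms R.H.definite_ip_axioms
  have T: "(\<lambda>h\<in>vcarrier HR. ST (iT h)) \<in> bounded_ops HR HR" (is "?T \<in> _")
    by (rule bounded_ops_compose[OF iT ST R(1) T.H.semi_ip_axioms])
  have "(\<lambda>h\<in>vcarrier HR. vadd HR (?T h) ((\<lambda>h\<in>vcarrier HR. vscale HR (- 1) ((\<lambda>h\<in>vcarrier HR. ?T (?T h)) h)) h))
      \<in> bounded_ops HR HR"
    by (intro bounded_ops_add bounded_ops_scale bounded_ops_compose[OF T T] T R)
  then show ?thesis
    by (simp add: compress_JT vdiff_def cong: restrict_cong)
qed

text \<open>The quadratic form of the compression is a sum of two squares, namely the squared norms
  of the two components of P applied to \<open>JT_adj h\<close>.\<close>

lemma compress_JT_positive: "positive_op HR (compress_P s t w (JT_op s t w))"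
  unfolding positive_op_def
proof (intro conjI ballI compress_JT_bounded)
  fix h
  assume h: "h \<in> vcarrier HR"
  let ?u = "ST (iT h)"
  let ?a = "vdiff HT (iT h) (iT ?u)" and ?b = "iW ?u"
  have "ip HT (iT ?u) (iT ?u) + ip HW ?b ?b = ip HT (iT h) (iT ?u)"
    using h ip_T_plus_W[of ?u ?u] ip_ST[of "iT h" ?u] by (simp del: ip_ST ip_ST_right)
  then have "ip HT ?a ?a + ip HW ?b ?b = ip HT (iT h) (iT h) - ip HT (iT ?u) (iT h)"
    using h by (simp add: algebra_simps)
  then have "ip HR (compress_P s t w (JT_op s t w) h) h = ip HT ?a ?a + ip HW ?b ?b"
    using h by (simp add: compress_JT)
  also have "\<dots> = complex_of_real ((vnorm HT ?a)\<^sup>2 + (vnorm HW ?b)\<^sup>2)"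
    using h T.H.ip_self[of ?a] W.H.ip_self[of ?b] by simp
  finally show "ip HR (compress_P s t w (JT_op s t w) h) h \<in> \<real>\<^sub>\<ge>\<^sub>0"
    by (simp only: nonneg_Reals_of_real_iff) simp
qed

lemma parallel_sum_self:
  "parallel_sum s t w x x = complex_of_real (INF y. Re (t (x - y) (x - y)) + Re (w y y))"
proof -
  let ?u = "ST (cT x)"
  let ?L = "Re (t x x) - (vnorm HR ?u)\<^sup>2"
  let ?f = "\<lambda>y. Re (t (x - y) (x - y)) + Re (w y y)"
  let ?d = "\<lambda>y. vnorm HR (vdiff HR (cR y) ?u)"
  have u: "?u \<in> vcarrier HR"
    by simp
  have "ip HR ?u ?u = ip HT (iT ?u) (cT x)"
    using ip_ST_right[of "cT x" ?u] by simp
  then have "parallel_sum s t w x x = t x x - complex_of_real ((vnorm HR ?u)\<^sup>2)"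
    using R.H.ip_self[OF u] by (simp add: parallel_sum_def Let_def compress_JT)
  then have sum: "parallel_sum s t w x x = complex_of_real ?L"
    by (simp add: complex_eq_iff T.form_self)
  \<comment> \<open>The cross terms match because t y x is the inner product of \<open>cR y\<close>
    with \<open>?u\<close>, and t y y + w y y is the squared norm of \<open>cR y\<close>.\<close>
  have square: "?f y = ?L + (?d y)\<^sup>2" for y
  proof -
    have "Re (t x y) = Re (t y x)"
      using T.form_cnj[of x y] by simp
    moreover have "ip HR (cR y) ?u = t y x" "ip HR ?u (cR y) = t x y"
      using ip_ST_right[of "cT x" "cR y"] ip_ST[of "cT x" "cR y"] by simp_all
    ultimately show ?thesis
      by (simp add: R.H.vnorm_sq T.form_diff T.form_diff_right form_sum_apply del: ip_ST ip_ST_right)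
  qed
  have "(INF y. ?f y) = ?L"
  proof (rule cInf_eq_non_empty)
    fix l
    assume l: "\<And>v. v \<in> range ?f \<Longrightarrow> l \<le> v"
    \<comment> \<open>The minimising vector T x need not be a coset, so the infimum is approached
      along cosets converging to it.\<close>
    obtain f where "vlim HR (\<lambda>n. cR (f n)) ?u"
      using R.coset_dense[OF u] by blast
    then have "(\<lambda>n. ?L + (?d (f n))\<^sup>2) \<longlonglongrightarrow> ?L + 0\<^sup>2"
      unfolding vlim_def by (intro tendsto_intros)
    moreover have "l \<le> ?L + (?d (f n))\<^sup>2" for n
      using l[OF rangeI, of "f n"] unfolding square .
    ultimately have "l \<le> ?L + 0\<^sup>2"
      by (intro LIMSEQ_le_const) auto
    then show "l \<le> ?L"
      by simp
  qed (auto simp: square)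
  then show ?thesis
    by (simp add: sum)
qed

end

theorem theorem3p1:
  fixes s :: "complex \<Rightarrow> 'a::ab_group_add \<Rightarrow> 'a"
    and t w :: "'a \<Rightarrow> 'a \<Rightarrow> complex"
  assumes "vector_space s"
    and "nonneg_form s t"
    and "nonneg_form s w"
  shows "positive_op (form_hilbert s (form_sum t w)) (compress_P s t w (JT_op s t w)) \<and>
    positive_op (form_hilbert s (form_sum t w)) (compress_P s t w (JW_op s t w)) \<and>
    compress_P s t w (JT_op s t w) = compress_P s t w (JW_op s t w) \<and>
    (\<forall>x. parallel_sum s t w x x =
       complex_of_real (INF y. Re (t (x - y) (x - y)) + Re (w y y)))"
proof -
  interpret T: herm_form s t
    by (rule herm_form.intro[OF assms(1,2)])
  interpret W: herm_form s w
    by (rule herm_form.intro[OF assms(1,3)])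
  have "nonneg_form s (form_sum t w)"
    using assms unfolding nonneg_form_def form_sum_def
    by (auto simp: Vector_Spaces.linear_iff algebra_simps complex_nonneg_Reals_iff)
  then have R: "herm_form s (form_sum t w)"
    by (rule herm_form.intro[OF assms(1)])
  have le: "Re (t x x) \<le> Re (form_sum t w x x)" "Re (w x x) \<le> Re (form_sum t w x x)" for x
    by (simp_all add: form_sum_apply T.form_self W.form_self)
  obtain ST iT where T: "ST \<in> bounded_ops (form_hilbert s t) (form_hilbert s (form_sum t w))"
    "iT \<in> bounded_ops (form_hilbert s (form_sum t w)) (form_hilbert s t)"
    "\<And>x. iT (coset s (form_sum t w) x) = coset s t x"
    "\<And>a h. a \<in> vcarrier (form_hilbert s t) \<Longrightarrow> h \<in> vcarrier (form_hilbert s (form_sum t w)) \<Longrightarrow>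
      ip (form_hilbert s (form_sum t w)) (ST a) h = ip (form_hilbert s t) a (iT h)"
    using dominated_form_transport[OF T.herm_form_axioms R le(1)] by blast
  obtain SW iW where W: "SW \<in> bounded_ops (form_hilbert s w) (form_hilbert s (form_sum t w))"
    "iW \<in> bounded_ops (form_hilbert s (form_sum t w)) (form_hilbert s w)"
    "\<And>x. iW (coset s (form_sum t w) x) = coset s w x"
    "\<And>a h. a \<in> vcarrier (form_hilbert s w) \<Longrightarrow> h \<in> vcarrier (form_hilbert s (form_sum t w)) \<Longrightarrow>
      ip (form_hilbert s (form_sum t w)) (SW a) h = ip (form_hilbert s w) a (iW h)"
    using dominated_form_transport[OF W.herm_form_axioms R le(2)] by blast
  interpret form_pair s t w ST SW iT iW
    by (intro form_pair.intro form_pair_axioms.intro T.herm_form_axioms W.herm_form_axioms R T W)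
  show ?thesis
    by (intro conjI allI parallel_sum_self compress_JT_positive compress_JT_eq_JW)
      \<comment> \<open>The remaining goal, positivity of the J_W compression, is carried over by
        the equality of the two operators.\<close>
      (simp only: compress_JT_positive flip: compress_JT_eq_JW)
qed

end
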